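(* Let $(M,D,g,f)$ be a compact gradient Hesse soliton, i.e. a compact Hessian manifold with a smooth function $f$ on $M$ and $\lambda\in\mathbb{R}$ such that $\beta-\nabla\nabla f=\lambda g$. If $\beta=\beta'$, where $\beta'$ is the second Koszul form of the dual Hessian structure $(D',g)$, then the soliton is trivial, i.e. $(M,D,g)$ is Hesse-Einstein.
   Context: All manifolds are smooth, without boundary. A connection $D$ on $TM$ is flat if it is torsion free and its curvature tensor vanishes. A Hessian manifold $(M,D,g)$ is a manifold $M$ with a flat connection $D$ and a Riemannian metric $g$ that is locally of the form $g=Dd\varphi$ for a smooth function $\varphi$, i.e. $g_{ij}=\partial_i\partial_j\varphi$ in affine coordinates (local coordinates with $D_{\partial_i}\partial_j=0$). $\nabla$ denotes the Levi-Civita connection of $g$, and $\nabla\nabla f$ the Hessian of $f$ with respect to $\nabla$. With $v_g$ the (local) volume form of $g$, the first Koszul form $\alpha$ and second Koszul form $\beta$ are defined by $D_Xv_g=\alpha(X)v_g$ and $\beta=D\alpha$. The dual connection is $D'=2\nabla-D$; it is again flat, and $(D',g)$ is again a Hessian structure (the dual Hessian structure). Its Koszul forms are $\alpha'$ and $\beta'$, given by $D'_Xv_g=\alpha'(X)v_g$ and $\beta'=D'\alpha'$. A Hessian manifold is Hesse-Einstein if $\beta=\lambda g$ for some constant $\lambda\in\mathbb{R}$. A Hesse soliton is called trivial if it is Hesse-Einstein. *)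

theory Defs
  imports "HOL-Analysis.Analysis"
begin

section \<open>Smooth maps between open sets\<close>

primrec k_differentiable_on ::
  "nat \<Rightarrow> 'a::real_normed_vector set \<Rightarrow> ('a \<Rightarrow> 'b::real_normed_vector) \<Rightarrow> bool" where
  "k_differentiable_on 0 S f \<longleftrightarrow> continuous_on S f"
| "k_differentiable_on (Suc k) S f \<longleftrightarrow> (\<forall>x\<in>S. f differentiable (at x)) \<and>
     (\<forall>v. k_differentiable_on k S (\<lambda>x. frechet_derivative f (at x) v))"

text \<open>Only used for open sets \<open>S\<close>, on which derivatives do not depend on values outside \<open>S\<close>.\<close>

definition smooth_on ::
  "'a::real_normed_vector set \<Rightarrow> ('a \<Rightarrow> 'b::real_normed_vector) \<Rightarrow> bool" where
  "smooth_on S f \<longleftrightarrow> (\<forall>k. k_differentiable_on k S f)"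

definition pderiv_at :: "'n \<Rightarrow> (real^'n \<Rightarrow> real) \<Rightarrow> real^'n \<Rightarrow> real" where
  "pderiv_at i f x = frechet_derivative f (at x) (axis i 1)"

section \<open>Smooth manifolds\<close>

text \<open>A chart is a pair \<open>(U, \<phi>)\<close> of a domain and a coordinate map; only the values of \<open>\<phi>\<close> on
  \<open>U\<close> matter. Manifolds need not be connected.\<close>

type_synonym ('m, 'n) chart = "'m set \<times> ('m \<Rightarrow> real^'n)"

definition chart_image :: "('m, 'n) chart \<Rightarrow> (real^'n) set" where
  "chart_image c = snd c ` fst c"

definition chart_inv :: "('m, 'n) chart \<Rightarrow> real^'n \<Rightarrow> 'm" where
  "chart_inv c = inv_into (fst c) (snd c)"

definition overlap :: "('m, 'n) chart \<Rightarrow> ('m, 'n) chart \<Rightarrow> (real^'n) set" where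
  "overlap c c' = snd c ` (fst c \<inter> fst c')"

definition transition :: "('m, 'n) chart \<Rightarrow> ('m, 'n) chart \<Rightarrow> real^'n \<Rightarrow> real^'n" where
  "transition c c' = snd c' \<circ> chart_inv c"

definition is_chart :: "'m topology \<Rightarrow> ('m, 'n::finite) chart \<Rightarrow> bool" where
  "is_chart M c \<longleftrightarrow> openin M (fst c) \<and> open (chart_image c) \<and>
     homeomorphic_map (subtopology M (fst c)) (top_of_set (chart_image c)) (snd c)"

definition smooth_manifold :: "'m topology \<Rightarrow> ('m, 'n::finite) chart set \<Rightarrow> bool" where
  "smooth_manifold M A \<longleftrightarrow>
     Hausdorff_space M \<and> second_countable M \<and>
     (\<forall>c\<in>A. is_chart M c) \<and> (\<Union>c\<in>A. fst c) = topspace M \<and>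
     (\<forall>c\<in>A. \<forall>c'\<in>A. smooth_on (overlap c c') (transition c c'))"

text \<open>\<open>jac c c' x m i\<close> is the derivative of the \<open>m\<close>-th coordinate of \<open>c'\<close> in the direction of the
  \<open>i\<close>-th coordinate of \<open>c\<close>.\<close>

definition jac ::
  "('m, 'n) chart \<Rightarrow> ('m, 'n) chart \<Rightarrow> real^'n \<Rightarrow> 'n \<Rightarrow> 'n \<Rightarrow> real" where
  "jac c c' x m i = pderiv_at i (\<lambda>y. transition c c' y $ m) x"

definition smooth_function ::
  "('m, 'n::finite) chart set \<Rightarrow> ('m \<Rightarrow> real) \<Rightarrow> bool" where
  "smooth_function A f \<longleftrightarrow> (\<forall>c\<in>A. smooth_on (chart_image c) (f \<circ> chart_inv c))"

section \<open>Riemannian metrics and connections\<close>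

text \<open>Tensor fields and connections on a manifold are families of coordinate components, one for
  each chart of the atlas, subject to the respective change-of-coordinates law. Values of the
  components outside the image of the chart are irrelevant.\<close>

type_synonym 'n local_metric = "real^'n \<Rightarrow> real^'n^'n"

definition riemannian_metric ::
  "('m, 'n::finite) chart set \<Rightarrow> (('m, 'n) chart \<Rightarrow> 'n local_metric) \<Rightarrow> bool" where
  "riemannian_metric A g \<longleftrightarrow>
     (\<forall>c\<in>A. \<forall>i j. smooth_on (chart_image c) (\<lambda>x. g c x $ i $ j)) \<and>
     (\<forall>c\<in>A. \<forall>x\<in>chart_image c.
        (\<forall>i j. g c x $ i $ j = g c x $ j $ i) \<and> (\<forall>v. v \<noteq> 0 \<longrightarrow> v \<bullet> (g c x *v v) > 0)) \<and>
     (\<forall>c\<in>A. \<forall>c'\<in>A. \<forall>x\<in>overlap c c'. \<forall>i j.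
        g c x $ i $ j =
          (\<Sum>a\<in>UNIV. \<Sum>b\<in>UNIV. jac c c' x a i * jac c c' x b j * g c' (transition c c' x) $ a $ b))"

text \<open>A connection on the tangent bundle is given by its Christoffel symbols: \<open>\<Gamma> x k i j\<close> is
  the coefficient of \<open>\<partial>\<^sub>k\<close> in the covariant derivative of \<open>\<partial>\<^sub>j\<close> along \<open>\<partial>\<^sub>i\<close>.\<close>

type_synonym 'n local_conn = "real^'n \<Rightarrow> 'n \<Rightarrow> 'n \<Rightarrow> 'n \<Rightarrow> real"

definition connection ::
  "('m, 'n::finite) chart set \<Rightarrow> (('m, 'n) chart \<Rightarrow> 'n local_conn) \<Rightarrow> bool" where
  "connection A D \<longleftrightarrow>
     (\<forall>c\<in>A. \<forall>k i j. smooth_on (chart_image c) (\<lambda>x. D c x k i j)) \<and>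
     (\<forall>c\<in>A. \<forall>c'\<in>A. \<forall>x\<in>overlap c c'. \<forall>m i j.
        (\<Sum>k\<in>UNIV. D c x k i j * jac c c' x m k) =
          pderiv_at i (\<lambda>y. jac c c' y m j) x +
          (\<Sum>a\<in>UNIV. \<Sum>b\<in>UNIV. jac c c' x a i * jac c c' x b j * D c' (transition c c' x) m a b))"

definition torsion :: "'n local_conn \<Rightarrow> 'n local_conn" where
  "torsion \<Gamma> x k i j = \<Gamma> x k i j - \<Gamma> x k j i"

text \<open>The coefficient of \<open>\<partial>\<^sub>l\<close> in \<open>R(\<partial>\<^sub>i, \<partial>\<^sub>j) \<partial>\<^sub>k\<close>.\<close>

definition curvature ::
  "'n::finite local_conn \<Rightarrow> real^'n \<Rightarrow> 'n \<Rightarrow> 'n \<Rightarrow> 'n \<Rightarrow> 'n \<Rightarrow> real" where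
  "curvature \<Gamma> x l i j k =
     pderiv_at i (\<lambda>y. \<Gamma> y l j k) x - pderiv_at j (\<lambda>y. \<Gamma> y l i k) x +
     (\<Sum>m\<in>UNIV. \<Gamma> x l i m * \<Gamma> x m j k - \<Gamma> x l j m * \<Gamma> x m i k)"

definition flat_connection ::
  "('m, 'n::finite) chart set \<Rightarrow> (('m, 'n) chart \<Rightarrow> 'n local_conn) \<Rightarrow> bool" where
  "flat_connection A D \<longleftrightarrow> connection A D \<and>
     (\<forall>c\<in>A. \<forall>x\<in>chart_image c.
        (\<forall>k i j. torsion (D c) x k i j = 0) \<and> (\<forall>l i j k. curvature (D c) x l i j k = 0))"

definition levi_civita ::
  "('m, 'n::finite) chart set \<Rightarrow> (('m, 'n) chart \<Rightarrow> 'n local_metric) \<Rightarrow>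
    (('m, 'n) chart \<Rightarrow> 'n local_conn) \<Rightarrow> bool" where
  "levi_civita A g nabla \<longleftrightarrow> connection A nabla \<and>
     (\<forall>c\<in>A. \<forall>x\<in>chart_image c.
        (\<forall>k i j. torsion (nabla c) x k i j = 0) \<and>
        (\<forall>k i j. pderiv_at k (\<lambda>y. g c y $ i $ j) x =
           (\<Sum>l\<in>UNIV. nabla c x l k i * g c x $ l $ j + nabla c x l k j * g c x $ i $ l)))"

text \<open>Component \<open>i j\<close> of the covariant derivative of a 1-form, the derivation index being \<open>i\<close>.\<close>

definition cov_deriv_form ::
  "'n::finite local_conn \<Rightarrow> (real^'n \<Rightarrow> 'n \<Rightarrow> real) \<Rightarrow> real^'n \<Rightarrow> 'n \<Rightarrow> 'n \<Rightarrow> real" where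
  "cov_deriv_form \<Gamma> a x i j = pderiv_at i (\<lambda>y. a y j) x - (\<Sum>k\<in>UNIV. \<Gamma> x k i j * a x k)"

definition hess ::
  "'n::finite local_conn \<Rightarrow> (real^'n \<Rightarrow> real) \<Rightarrow> real^'n \<Rightarrow> 'n \<Rightarrow> 'n \<Rightarrow> real" where
  "hess \<Gamma> h = cov_deriv_form \<Gamma> (\<lambda>y k. pderiv_at k h y)"

section \<open>Koszul forms\<close>

text \<open>The value at \<open>x\<close> of the local volume form, for the orientation given by the chart, on the
  tangent vectors \<open>X i\<close>. The opposite orientation leads to the same Koszul forms.\<close>

definition vol_form :: "'n::finite local_metric \<Rightarrow> real^'n \<Rightarrow> ('n \<Rightarrow> real^'n) \<Rightarrow> real" where
  "vol_form \<gamma> x X = sqrt (det (\<gamma> x)) * det (\<chi> i. X i)"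

text \<open>Covariant derivative along \<open>\<partial>\<^sub>k\<close> of a form \<open>\<omega>\<close> of top degree, evaluated on vector fields
  \<open>X i\<close> with constant coefficients.\<close>

definition cov_deriv_top ::
  "'n::finite local_conn \<Rightarrow> (real^'n \<Rightarrow> ('n \<Rightarrow> real^'n) \<Rightarrow> real) \<Rightarrow>
    real^'n \<Rightarrow> 'n \<Rightarrow> ('n \<Rightarrow> real^'n) \<Rightarrow> real" where
  "cov_deriv_top \<Gamma> \<omega> x k X = pderiv_at k (\<lambda>y. \<omega> y X) x -
     (\<Sum>i\<in>UNIV. \<omega> x (X(i := (\<chi> l. \<Sum>j\<in>UNIV. \<Gamma> x l k j * X i $ j))))"

text \<open>The first Koszul form is the ratio of the covariant derivative of the volume form to the
  volume form. Both have top degree, so they may be compared on the coordinate frame.\<close>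

definition koszul1 ::
  "'n::finite local_conn \<Rightarrow> 'n local_metric \<Rightarrow> real^'n \<Rightarrow> 'n \<Rightarrow> real" where
  "koszul1 \<Gamma> \<gamma> x k =
     cov_deriv_top \<Gamma> (vol_form \<gamma>) x k (\<lambda>i. axis i 1) / vol_form \<gamma> x (\<lambda>i. axis i 1)"

definition koszul2 ::
  "'n::finite local_conn \<Rightarrow> 'n local_metric \<Rightarrow> real^'n \<Rightarrow> 'n \<Rightarrow> 'n \<Rightarrow> real" where
  "koszul2 \<Gamma> \<gamma> = cov_deriv_form \<Gamma> (koszul1 \<Gamma> \<gamma>)"

section \<open>Hessian manifolds and Hesse solitons\<close>

definition hessian_manifold ::
  "'m topology \<Rightarrow> ('m, 'n::finite) chart set \<Rightarrow> (('m, 'n) chart \<Rightarrow> 'n local_conn) \<Rightarrow>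
    (('m, 'n) chart \<Rightarrow> 'n local_metric) \<Rightarrow> bool" where
  "hessian_manifold M A D g \<longleftrightarrow>
     smooth_manifold M A \<and> flat_connection A D \<and> riemannian_metric A g \<and>
     (\<forall>c\<in>A. \<forall>x\<in>chart_image c. \<exists>V h. open V \<and> x \<in> V \<and> V \<subseteq> chart_image c \<and> smooth_on V h \<and>
        (\<forall>y\<in>V. \<forall>i j. g c y $ i $ j = hess (D c) h y i j))"

definition dual_conn ::
  "(('m, 'n) chart \<Rightarrow> 'n local_conn) \<Rightarrow> (('m, 'n) chart \<Rightarrow> 'n local_conn) \<Rightarrow>
    ('m, 'n) chart \<Rightarrow> 'n local_conn" where
  "dual_conn nabla D c x k i j = 2 * nabla c x k i j - D c x k i j"

definition gradient_hesse_soliton ::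
  "'m topology \<Rightarrow> ('m, 'n::finite) chart set \<Rightarrow> (('m, 'n) chart \<Rightarrow> 'n local_conn) \<Rightarrow>
    (('m, 'n) chart \<Rightarrow> 'n local_metric) \<Rightarrow> (('m, 'n) chart \<Rightarrow> 'n local_conn) \<Rightarrow>
    ('m \<Rightarrow> real) \<Rightarrow> real \<Rightarrow> bool" where
  "gradient_hesse_soliton M A D g nabla f lam \<longleftrightarrow>
     hessian_manifold M A D g \<and> levi_civita A g nabla \<and> smooth_function A f \<and>
     (\<forall>c\<in>A. \<forall>x\<in>chart_image c. \<forall>i j.
        koszul2 (D c) (g c) x i j - hess (nabla c) (f \<circ> chart_inv c) x i j = lam * g c x $ i $ j)"

definition hesse_einstein ::
  "'m topology \<Rightarrow> ('m, 'n::finite) chart set \<Rightarrow> (('m, 'n) chart \<Rightarrow> 'n local_conn) \<Rightarrow>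
    (('m, 'n) chart \<Rightarrow> 'n local_metric) \<Rightarrow> bool" where
  "hesse_einstein M A D g \<longleftrightarrow> hessian_manifold M A D g \<and>
     (\<exists>\<mu>. \<forall>c\<in>A. \<forall>x\<in>chart_image c. \<forall>i j. koszul2 (D c) (g c) x i j = \<mu> * g c x $ i $ j)"

end

theory Submission
  imports Defs
begin

text \<open>Write \<open>\<gamma> = \<nabla> - D\<close>. As \<open>\<nabla> v\<^sub>g = 0\<close>, the first Koszul form is \<open>\<alpha>(X) = tr \<gamma>\<^sub>X\<close>, and \<open>\<alpha>' = - \<alpha>\<close>.
  Hence \<open>\<beta> = \<nabla>\<alpha> + \<alpha> \<circ> \<gamma>\<close> and \<open>\<beta>' = - \<nabla>\<alpha> + \<alpha> \<circ> \<gamma>\<close>, so that \<open>\<beta> = \<beta>'\<close> means \<open>\<nabla>\<alpha> = 0\<close>. By the Codazzi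
  equation \<open>\<gamma>\<close> is totally symmetric, and the trace of the soliton equation becomes
  \<open>\<Delta>f = \<bar>\<alpha>\<bar>\<^sup>2 - n \<lambda>\<close>, which is locally constant. At a maximum and at a minimum of \<open>f\<close> on a clopen set
  this constant is \<open>\<le> 0\<close> and \<open>\<ge> 0\<close>; therefore \<open>\<Delta>f = 0\<close>, and the strong maximum
  principle makes \<open>f\<close> constant on each component, whence \<open>\<beta> = \<lambda> g\<close>.\<close>

section \<open>Partial derivatives\<close>

text \<open>Total symmetry is needed for the trace because \<alpha> contracts an upper with a lower
  index of \<gamma>, whereas the metric trace of \<alpha> \<circ> \<gamma> contracts the two lower
  ones; once the index is lowered, both are the same contraction, and the trace becomes
  |\<alpha>|^2. Looking at extrema of f takes the place of integrating the Laplacian over M, so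
  neither a measure nor an orientation enters. Two features shape the global part: M is not assumed
  connected, and |\<alpha>|^2 exists at first only chart by chart. It descends to a function on M
  because \<gamma>, as a difference of connections, is a tensor, and the sign of |\<alpha>|^2 - n
  \<lambda> is tested on clopen sets rather than on M as a whole. In the end local constancy of f
  suffices: its Hessian vanishes, and the constant \<lambda> of the soliton serves all components at
  once.\<close>

lemma pderiv_at_eq:
  assumes "(f has_derivative f') (at x)"
  shows "pderiv_at i f x = f' (axis i 1)"
  using assms frechet_derivative_at[OF assms] by (simp add: pderiv_at_def)

lemma has_real_derivative_along_line:
  fixes f :: "real^'n \<Rightarrow> real"
  assumes "f differentiable (at (x + t *\<^sub>R v))"
  shows "((\<lambda>s. f (x + s *\<^sub>R v)) has_real_derivative (\<Sum>i\<in>UNIV. v $ i * pderiv_at i f (x + t *\<^sub>R v))) (at t)"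
proof -
  let ?D = "frechet_derivative f (at (x + t *\<^sub>R v))"
  have D: "(f has_derivative ?D) (at (x + t *\<^sub>R v))"
    using assms frechet_derivative_works by blast
  have "((\<lambda>s. x + s *\<^sub>R v) has_derivative (\<lambda>s. s *\<^sub>R v)) (at t)"
    by (auto intro!: derivative_eq_intros)
  then have d: "((\<lambda>s. f (x + s *\<^sub>R v)) has_derivative (\<lambda>s. ?D (s *\<^sub>R v))) (at t)"
    using has_derivative_compose[of "\<lambda>s. x + s *\<^sub>R v" "\<lambda>s. s *\<^sub>R v" t UNIV f ?D] D by auto
  have lin: "linear ?D" using D has_derivative_linear by blast
  have "?D v = ?D (\<Sum>i\<in>UNIV. v $ i *\<^sub>R axis i 1)"
    using basis_expansion[of v] by (simp add: scalar_mult_eq_scaleR)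
  also have "\<dots> = (\<Sum>i\<in>UNIV. v $ i * pderiv_at i f (x + t *\<^sub>R v))"
    by (simp add: linear_sum[OF lin] linear_scale[OF lin] pderiv_at_def)
  finally have "?D (s *\<^sub>R v) = (\<Sum>i\<in>UNIV. v $ i * pderiv_at i f (x + t *\<^sub>R v)) * s" for s
    by (simp add: linear_scale[OF lin])
  with d show ?thesis by (simp add: has_field_derivative_def)
qed

lemma has_real_derivative_along_axis:
  fixes f :: "real^'n \<Rightarrow> real"
  assumes "f differentiable (at (x + t *\<^sub>R axis i 1))"
  shows "((\<lambda>s. f (x + s *\<^sub>R axis i 1)) has_real_derivative pderiv_at i f (x + t *\<^sub>R axis i 1)) (at t)"
  using has_real_derivative_along_line[OF assms] by (simp add: axis_def if_distrib if_distribR cong: if_cong)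

lemma pderiv_at_cong:
  assumes "open U" "x \<in> U" "\<And>y. y \<in> U \<Longrightarrow> f y = h y"
  shows "pderiv_at i f x = pderiv_at i h x"
proof -
  \<comment> \<open>\<open>frechet_derivative\<close> is chosen from the set of all derivatives, so
    equal sets give equal choices, even at points where neither function is differentiable.\<close>
  have "(f has_derivative f') (at x) \<longleftrightarrow> (h has_derivative f') (at x)" for f'
    using has_derivative_transform_within_open[of f f' x UNIV U h]
      has_derivative_transform_within_open[of h f' x UNIV U f] assms by auto
  then show ?thesis by (simp add: pderiv_at_def frechet_derivative_def)
qed

lemma differentiable_cong_open:
  assumes "f differentiable (at x)" "open U" "x \<in> U" "\<And>y. y \<in> U \<Longrightarrow> f y = h y"
  shows "h differentiable (at x)"
proof -
  obtain f' where "(f has_derivative f') (at x)" using assms(1) by (auto simp: differentiable_def)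
  then have "(h has_derivative f') (at x)"
    using has_derivative_transform_within_open[of f f' x UNIV U h] assms by auto
  then show ?thesis by (auto simp: differentiable_def)
qed

lemma
  assumes f: "f differentiable (at x)" and h: "h differentiable (at x)"
  shows pderiv_at_add: "pderiv_at i (\<lambda>y. f y + h y) x = pderiv_at i f x + pderiv_at i h x"
    and pderiv_at_diff: "pderiv_at i (\<lambda>y. f y - h y) x = pderiv_at i f x - pderiv_at i h x"
    and pderiv_at_mult: "pderiv_at i (\<lambda>y. f y * h y) x = f x * pderiv_at i h x + pderiv_at i f x * h x"
proof -
  note d = f[unfolded frechet_derivative_works] h[unfolded frechet_derivative_works]
  show "pderiv_at i (\<lambda>y. f y + h y) x = pderiv_at i f x + pderiv_at i h x"
    using pderiv_at_eq[OF has_derivative_add[OF d]] by (simp add: pderiv_at_def)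
  show "pderiv_at i (\<lambda>y. f y - h y) x = pderiv_at i f x - pderiv_at i h x"
    using pderiv_at_eq[OF has_derivative_diff[OF d]] by (simp add: pderiv_at_def)
  show "pderiv_at i (\<lambda>y. f y * h y) x = f x * pderiv_at i h x + pderiv_at i f x * h x"
    using pderiv_at_eq[OF has_derivative_mult[OF d]] by (simp add: pderiv_at_def)
qed

lemma pderiv_at_const [simp]: "pderiv_at i (\<lambda>y. c) x = 0"
  by (rule pderiv_at_eq[where f' = "\<lambda>_. 0", simplified]) simp

lemma pderiv_at_cmult:
  assumes "f differentiable (at x)"
  shows "pderiv_at i (\<lambda>y. c * f y) x = c * pderiv_at i f x"
  using pderiv_at_mult[of "\<lambda>_. c", OF _ assms] by simp

lemma pderiv_at_minus:
  assumes "f differentiable (at x)"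
  shows "pderiv_at i (\<lambda>y. - f y) x = - pderiv_at i f x"
  using pderiv_at_cmult[OF assms, of i "-1"] by simp

lemma pderiv_at_sum:
  assumes "\<And>k. k \<in> K \<Longrightarrow> f k differentiable (at x)"
  shows "pderiv_at i (\<lambda>y. \<Sum>k\<in>K. f k y) x = (\<Sum>k\<in>K. pderiv_at i (f k) x)"
  using pderiv_at_eq[of "\<lambda>y. \<Sum>k\<in>K. f k y" "\<lambda>v. \<Sum>k\<in>K. frechet_derivative (f k) (at x) v" x i]
    has_derivative_sum[of K f "\<lambda>k. frechet_derivative (f k) (at x)"] assms[unfolded frechet_derivative_works]
  by (simp add: pderiv_at_def)

lemma differentiable_sum':
  "(\<And>k. k \<in> K \<Longrightarrow> f k differentiable (at x)) \<Longrightarrow> (\<lambda>y. \<Sum>k\<in>K. f k y) differentiable (at x)"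
  by (cases "finite K") (auto intro: differentiable_sum)

lemma constant_on_ball_if_pderiv_zero:
  fixes f :: "real^'n \<Rightarrow> real"
  assumes "\<And>y. y \<in> ball x e \<Longrightarrow> f differentiable (at y)"
    and "\<And>y i. y \<in> ball x e \<Longrightarrow> pderiv_at i f y = 0"
    and "y \<in> ball x e"
  shows "f y = f x"
proof -
  have "(f has_derivative (\<lambda>h. 0)) (at z within ball x e)" if "z \<in> ball x e" for z
  proof -
    let ?D = "frechet_derivative f (at z)"
    have D: "(f has_derivative ?D) (at z)"
      using assms(1)[OF that] frechet_derivative_works by blast
    then have lin: "linear ?D" by (rule has_derivative_linear)
    have "?D v = 0" for v
    proof -
      have "?D v = ?D (\<Sum>i\<in>UNIV. v $ i *\<^sub>R axis i 1)"
        using basis_expansion[of v] by (simp add: scalar_mult_eq_scaleR)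
      also have "\<dots> = (\<Sum>i\<in>UNIV. v $ i * pderiv_at i f z)"
        by (simp add: linear_sum[OF lin] linear_scale[OF lin] pderiv_at_def)
      finally show ?thesis using assms(2)[OF that] by simp
    qed
    then have "?D = (\<lambda>h. 0)" by auto
    with D show ?thesis using has_derivative_at_withinI[of f "\<lambda>h. 0" z "ball x e"] by simp
  qed
  then obtain c where "\<And>z. z \<in> ball x e \<Longrightarrow> f z = c"
    using has_derivative_zero_constant[of "ball x e" f] by auto
  moreover have "x \<in> ball x e"
    using assms(3) le_less_trans[OF zero_le_dist] by auto
  ultimately show ?thesis using assms(3) by metis
qed

text \<open>The mean value theorem applied twice to the second difference of \<open>f\<close>.\<close>

lemma second_difference_mvt:
  fixes f :: "real^'n \<Rightarrow> real"
  assumes d: "\<And>y. y \<in> ball x r \<Longrightarrow> f differentiable (at y)"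
    and d2: "\<And>y. y \<in> ball x r \<Longrightarrow> (\<lambda>z. pderiv_at i f z) differentiable (at y)"
    and h: "0 < h" "2 * h < r"
  shows "\<exists>y. dist x y \<le> 2 * h \<and>
    f (x + h *\<^sub>R axis i 1 + h *\<^sub>R axis j 1) - f (x + h *\<^sub>R axis i 1)
      - f (x + h *\<^sub>R axis j 1) + f x = h * h * pderiv_at j (pderiv_at i f) y"
proof -
  have near: "dist x (x + s *\<^sub>R axis i 1 + t *\<^sub>R axis j 1) \<le> 2 * h"
    if "0 \<le> s" "s \<le> h" "0 \<le> t" "t \<le> h" for s t
  proof -
    have "norm (s *\<^sub>R axis i (1::real) + t *\<^sub>R axis j 1 :: real^'n) \<le> \<bar>s\<bar> + \<bar>t\<bar>"
      by (rule norm_triangle_le) (simp add: norm_axis_1)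
    moreover have "dist x (x + s *\<^sub>R axis i 1 + t *\<^sub>R axis j 1) = norm (s *\<^sub>R axis i (1::real) + t *\<^sub>R axis j 1 :: real^'n)"
      by (subst dist_commute) (simp only: dist_norm add.assoc add_diff_cancel_left')
    ultimately show ?thesis using that by linarith
  qed
  have near': "x + s *\<^sub>R axis i 1 + t *\<^sub>R axis j 1 \<in> ball x r"
    if "0 \<le> s" "s \<le> h" "0 \<le> t" "t \<le> h" for s t
    using near[OF that] h by simp
  \<comment> \<open>The second difference is \<open>u h - u 0\<close>. Its mean value form is again
    a difference, now of \<open>pderiv_at i f\<close> in direction \<open>j\<close>, to which the
    theorem applies once more.\<close>
  define u where "u s = f (x + h *\<^sub>R axis j 1 + s *\<^sub>R axis i 1) - f (x + s *\<^sub>R axis i 1)" for s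
  have du: "(u has_real_derivative pderiv_at i f (x + h *\<^sub>R axis j 1 + s *\<^sub>R axis i 1) - pderiv_at i f (x + s *\<^sub>R axis i 1)) (at s)"
    if "0 \<le> s" "s \<le> h" for s
    unfolding u_def
  proof (intro DERIV_diff has_real_derivative_along_axis d)
    show "x + h *\<^sub>R axis j 1 + s *\<^sub>R axis i 1 \<in> ball x r"
      using near'[OF that, of h] h by (simp add: algebra_simps)
    show "x + s *\<^sub>R axis i 1 \<in> ball x r"
      using near'[OF that, of 0] h by simp
  qed
  obtain s where s: "0 < s" "s < h" and us: "u h - u 0 = (h - 0) * (pderiv_at i f (x + h *\<^sub>R axis j 1 + s *\<^sub>R axis i 1) - pderiv_at i f (x + s *\<^sub>R axis i 1))"
    using MVT2[of 0 h u, OF h(1) du] by blast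
  define w where "w t = pderiv_at i f (x + s *\<^sub>R axis i 1 + t *\<^sub>R axis j 1)" for t
  have dw: "(w has_real_derivative pderiv_at j (pderiv_at i f) (x + s *\<^sub>R axis i 1 + t *\<^sub>R axis j 1)) (at t)"
    if "0 \<le> t" "t \<le> h" for t
    unfolding w_def
    by (rule has_real_derivative_along_axis[of "pderiv_at i f"], rule d2) (use near' that s in auto)
  obtain t where t: "0 < t" "t < h" and wt: "w h - w 0 = (h - 0) * pderiv_at j (pderiv_at i f) (x + s *\<^sub>R axis i 1 + t *\<^sub>R axis j 1)"
    using MVT2[of 0 h w, OF h(1) dw] by blast
  have "u h - u 0 = h * h * pderiv_at j (pderiv_at i f) (x + s *\<^sub>R axis i 1 + t *\<^sub>R axis j 1)"
    using us wt by (simp add: w_def algebra_simps)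
  moreover have "dist x (x + s *\<^sub>R axis i 1 + t *\<^sub>R axis j 1) \<le> 2 * h"
    using near s t by simp
  ultimately show ?thesis
    by (intro exI[of _ "x + s *\<^sub>R axis i 1 + t *\<^sub>R axis j 1"]) (simp add: u_def algebra_simps)
qed

text \<open>The second difference is symmetric in \<open>i\<close> and \<open>j\<close>, so the two
  mixed derivatives take a common value, each at its own point arbitrarily near \<open>x\<close>;
  continuity brings both points to \<open>x\<close>.\<close>

lemma pderiv_at_commute:
  fixes f :: "real^'n \<Rightarrow> real"
  assumes U: "open U" "x \<in> U"
    and d: "\<And>y. y \<in> U \<Longrightarrow> f differentiable (at y)"
    and d2: "\<And>y i. y \<in> U \<Longrightarrow> (\<lambda>z. pderiv_at i f z) differentiable (at y)"
    and c: "\<And>i j. continuous_on U (\<lambda>y. pderiv_at j (pderiv_at i f) y)"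
  shows "pderiv_at j (pderiv_at i f) x = pderiv_at i (pderiv_at j f) x"
proof (rule ccontr)
  let ?a = "\<lambda>y. pderiv_at j (pderiv_at i f) y" and ?b = "\<lambda>y. pderiv_at i (pderiv_at j f) y"
  assume ne: "?a x \<noteq> ?b x"
  \<comment> \<open>Half of the gap, since two continuity errors add up.\<close>
  define e where "e = \<bar>?a x - ?b x\<bar> / 2"
  have e: "e > 0" using ne by (simp add: e_def)
  obtain r where r: "r > 0" "ball x r \<subseteq> U"
    using U open_contains_ball by blast
  have "isCont ?a x" "isCont ?b x"
    using c[of i j] c[of j i] U by (simp_all add: continuous_on_eq_continuous_at)
  then have "\<exists>d>0. \<forall>y. dist y x < d \<longrightarrow> dist (?a y) (?a x) < e"
    "\<exists>d>0. \<forall>y. dist y x < d \<longrightarrow> dist (?b y) (?b x) < e"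
    unfolding continuous_at_eps_delta using e by auto
  then obtain d1 d2 where d1: "d1 > 0" "\<And>y. dist y x < d1 \<Longrightarrow> dist (?a y) (?a x) < e"
    and d2': "d2 > 0" "\<And>y. dist y x < d2 \<Longrightarrow> dist (?b y) (?b x) < e"
    by blast
  \<comment> \<open>The intermediate points lie within \<open>2 * h\<close> of \<open>x\<close>; a
    quarter of the smallest radius keeps them strictly inside all three balls.\<close>
  define h where "h = min r (min d1 d2) / 4"
  have h: "0 < h" "2 * h < r" "2 * h < d1" "2 * h < d2"
    using r d1 d2' by (auto simp: h_def min_def)
  have sub: "\<And>y. y \<in> ball x r \<Longrightarrow> y \<in> U" using r by auto
  obtain y where y: "dist x y \<le> 2 * h" "f (x + h *\<^sub>R axis i 1 + h *\<^sub>R axis j 1) - f (x + h *\<^sub>R axis i 1)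
      - f (x + h *\<^sub>R axis j 1) + f x = h * h * ?a y"
    using second_difference_mvt[of x r f i h j] d d2 sub h by blast
  obtain z where z: "dist x z \<le> 2 * h" "f (x + h *\<^sub>R axis j 1 + h *\<^sub>R axis i 1) - f (x + h *\<^sub>R axis j 1)
      - f (x + h *\<^sub>R axis i 1) + f x = h * h * ?b z"
    using second_difference_mvt[of x r f j h i] d d2 sub h by blast
  have comm: "x + h *\<^sub>R axis j 1 + h *\<^sub>R axis i 1 = x + h *\<^sub>R axis i 1 + h *\<^sub>R axis j 1" by simp
  have "h * h * ?a y = h * h * ?b z"
    using y(2) z(2)[unfolded comm] by linarith
  then have "?a y = ?b z" using h by simp
  moreover have "\<bar>?a y - ?a x\<bar> < e" "\<bar>?b z - ?b x\<bar> < e"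
    using d1(2)[of y] d2'(2)[of z] y(1) z(1) h by (auto simp: dist_real_def dist_commute)
  ultimately show False unfolding e_def by (simp add: abs_if split: if_splits)
qed

section \<open>The strong maximum principle\<close>

text \<open>Induction on \<open>S\<close>, splitting off the rank one part of \<open>a\<close> through \<open>s\<close> as in the Cholesky
  decomposition.\<close>

lemma sum_pos_def_mult_nonneg:
  fixes a H :: "'n \<Rightarrow> 'n \<Rightarrow> real"
  assumes "finite S" "\<And>i j. a i j = a j i"
    and "\<And>v. (\<exists>i\<in>S. v i \<noteq> 0) \<Longrightarrow> 0 < (\<Sum>i\<in>S. \<Sum>j\<in>S. a i j * v i * v j)"
    and "\<And>v. 0 \<le> (\<Sum>i\<in>S. \<Sum>j\<in>S. H i j * v i * v j)"
  shows "0 \<le> (\<Sum>i\<in>S. \<Sum>j\<in>S. a i j * H i j)"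
  using assms
proof (induction S arbitrary: a rule: finite_induct)
  case empty
  then show ?case by simp
next
  case (insert s S)
  have expand: "(\<Sum>i\<in>insert s S. \<Sum>j\<in>insert s S. F i j) =
      F s s + (\<Sum>j\<in>S. F s j) + (\<Sum>i\<in>S. F i s) + (\<Sum>i\<in>S. \<Sum>j\<in>S. F i j)" for F :: "'n \<Rightarrow> 'n \<Rightarrow> real"
    using insert.hyps by (simp add: sum.distrib)
  have upd: "(\<Sum>j\<in>S. F j ((v(s := t)) j)) = (\<Sum>j\<in>S. F j (v j))" for F :: "'n \<Rightarrow> real \<Rightarrow> real" and v t
    by (rule sum.cong) (use insert.hyps in auto)
  define p where "p = a s s"
  have p: "p > 0"
  proof -
    have "(\<Sum>j\<in>S. a s j * (if j = s then 1 else 0)) = 0" "(\<Sum>j\<in>S. a j s * (if j = s then 1 else 0)) = 0"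
      "(\<Sum>i\<in>S. \<Sum>j\<in>S. a i j * (if i = s then 1 else 0) * (if j = s then 1 else 0)) = 0"
      using insert.hyps by (auto intro!: sum.neutral)
    then show ?thesis
      using insert.prems(2)[of "\<lambda>i. if i = s then 1 else 0"] unfolding expand by (simp add: p_def)
  qed
  \<comment> \<open>The Schur complement of the pivot \<open>a s s\<close>.\<close>
  define a' where "a' i j = a i j - a s i * a s j / p" for i j
  have "0 \<le> (\<Sum>i\<in>S. \<Sum>j\<in>S. a' i j * H i j)"
  proof (rule insert.IH)
    show "a' i j = a' j i" for i j
      using insert.prems(1)[of i j] by (simp add: a'_def)
    show "0 < (\<Sum>i\<in>S. \<Sum>j\<in>S. a' i j * v i * v j)" if "\<exists>i\<in>S. v i \<noteq> 0" for v
    proof -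
      define L where "L = (\<Sum>j\<in>S. a s j * v j)"
      \<comment> \<open>This value at \<open>s\<close> minimises the form of \<open>a\<close> among
        all extensions of \<open>v\<close>, and the minimum is the form of \<open>a'\<close> at
        \<open>v\<close>.\<close>
      define w where "w = v(s := - L / p)"
      have w: "w s = - L / p" "\<And>j. j \<in> S \<Longrightarrow> w j = v j"
        using insert.hyps by (auto simp: w_def)
      have "\<exists>i\<in>insert s S. w i \<noteq> 0" using that w by auto
      then have "0 < (\<Sum>i\<in>insert s S. \<Sum>j\<in>insert s S. a i j * w i * w j)"
        by (rule insert.prems(2))
      also have "\<dots> = p * (L / p) * (L / p) - 2 * (L / p) * L + (\<Sum>i\<in>S. \<Sum>j\<in>S. a i j * v i * v j)"
      proof -
        have "(\<Sum>j\<in>S. a s j * w s * w j) = (- L / p) * L"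
        proof -
          have "(\<Sum>j\<in>S. a s j * w s * w j) = w s * L"
            unfolding L_def sum_distrib_left by (rule sum.cong) (simp_all add: w(2))
          then show ?thesis by (simp only: w(1))
        qed
        moreover have "(\<Sum>j\<in>S. a j s * w j * w s) = (- L / p) * L"
        proof -
          have "(\<Sum>j\<in>S. a j s * w j * w s) = w s * L"
            unfolding L_def sum_distrib_left
            by (rule sum.cong) (simp_all add: w(2) insert.prems(1)[of s])
          then show ?thesis by (simp only: w(1))
        qed
        moreover have "(\<Sum>i\<in>S. \<Sum>j\<in>S. a i j * w i * w j) = (\<Sum>i\<in>S. \<Sum>j\<in>S. a i j * v i * v j)"
          using w by (intro sum.cong) auto
        ultimately show ?thesis unfolding expand w(1) by (simp add: p_def)
      qed
      also have "\<dots> = (\<Sum>i\<in>S. \<Sum>j\<in>S. a i j * v i * v j) - L * L / p"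
        using p by (simp add: field_simps)
      also have "\<dots> = (\<Sum>i\<in>S. \<Sum>j\<in>S. a' i j * v i * v j)"
      proof -
        have "L * L / p = (\<Sum>i\<in>S. \<Sum>j\<in>S. a s i * a s j / p * v i * v j)"
          unfolding L_def sum_product sum_divide_distrib by (intro sum.cong refl) simp
        then show ?thesis by (simp only: a'_def sum_subtractf left_diff_distrib)
      qed
      finally show ?thesis .
    qed
    show "0 \<le> (\<Sum>i\<in>S. \<Sum>j\<in>S. H i j * v i * v j)" for v
    proof -
      have z: "(v(s := 0)) j = v j" if "j \<in> S" for j using that insert.hyps by auto
      have "(\<Sum>i\<in>S. \<Sum>j\<in>S. H i j * (v(s := 0)) i * (v(s := 0)) j) = (\<Sum>i\<in>S. \<Sum>j\<in>S. H i j * v i * v j)"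
        using z by (intro sum.cong) auto
      then show ?thesis using insert.prems(3)[of "v(s := 0)"] unfolding expand by simp
    qed
  qed
  \<comment> \<open>The rank one part contributes the form of \<open>H\<close> at the row
    \<open>a s\<close>, divided by the positive pivot.\<close>
  moreover have "(\<Sum>i\<in>insert s S. \<Sum>j\<in>insert s S. a i j * H i j) =
      (\<Sum>i\<in>insert s S. \<Sum>j\<in>insert s S. H i j * a s i * a s j) / p + (\<Sum>i\<in>S. \<Sum>j\<in>S. a' i j * H i j)"
  proof -
    have "(\<Sum>i\<in>S. \<Sum>j\<in>S. a' i j * H i j) = (\<Sum>i\<in>S. \<Sum>j\<in>S. a i j * H i j) - (\<Sum>i\<in>S. \<Sum>j\<in>S. H i j * a s i * a s j) / p"
    proof -
      have "(\<Sum>i\<in>S. \<Sum>j\<in>S. H i j * a s i * a s j) / p = (\<Sum>i\<in>S. \<Sum>j\<in>S. a s i * a s j / p * H i j)"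
        unfolding sum_divide_distrib by (intro sum.cong refl) simp
      then show ?thesis by (simp only: a'_def sum_subtractf left_diff_distrib)
    qed
    moreover have "(\<Sum>j\<in>S. H s j * a s s * a s j) / p = (\<Sum>j\<in>S. a s j * H s j)"
      unfolding sum_divide_distrib using p by (intro sum.cong refl) (simp add: p_def)
    moreover have "(\<Sum>i\<in>S. H i s * a s i * a s s) / p = (\<Sum>i\<in>S. a i s * H i s)"
      unfolding sum_divide_distrib
    proof (intro sum.cong refl)
      show "H i s * a s i * a s s / p = a i s * H i s" for i
        using insert.prems(1)[of i s] p by (simp add: p_def)
    qed
    moreover have "H s s * a s s * a s s / p = a s s * H s s" using p by (simp add: p_def)
    ultimately show ?thesis unfolding expand add_divide_distrib by linarith
  qed
  moreover have "0 \<le> (\<Sum>i\<in>insert s S. \<Sum>j\<in>insert s S. H i j * a s i * a s j) / p"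
    using insert.prems(3)[of "a s"] p by simp
  ultimately show ?case by simp
qed

text \<open>Everything happens on lines through \<open>x\<close>. If the second derivative along one
  were positive, the first derivative would be positive right after \<open>0\<close>, and by the
  mean value theorem \<open>f\<close> would exceed \<open>f x\<close> there.\<close>

lemma local_max_derivatives:
  fixes f :: "real^'n \<Rightarrow> real"
  assumes r: "r > 0" and max: "\<And>y. y \<in> ball x r \<Longrightarrow> f y \<le> f x"
    and d: "\<And>y. y \<in> ball x r \<Longrightarrow> f differentiable (at y)"
    and d2: "\<And>i. (\<lambda>y. pderiv_at i f y) differentiable (at x)"
  shows "pderiv_at i f x = 0"
    and "(\<Sum>i\<in>UNIV. \<Sum>j\<in>UNIV. pderiv_at j (pderiv_at i f) x * v i * v j) \<le> 0"
proof -
  define \<psi> where "\<psi> v t = (\<Sum>i\<in>UNIV. v $ i * pderiv_at i f (x + t *\<^sub>R v))" for v t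
  \<comment> \<open>The summand \<open>1\<close> keeps the bound meaningful for
    \<open>v = 0\<close>.\<close>
  have near: "x + t *\<^sub>R v \<in> ball x r" if "\<bar>t\<bar> < r / (norm v + 1)" for t and v :: "real^'n"
  proof -
    have "\<bar>t\<bar> * norm v \<le> \<bar>t\<bar> * (norm v + 1)" by (simp add: mult_left_mono)
    also have "\<dots> < r" using that pos_less_divide_eq[of "norm v + 1" "\<bar>t\<bar>" r] norm_ge_zero[of v] by linarith
    finally show ?thesis by (simp add: dist_norm)
  qed
  have der: "((\<lambda>s. f (x + s *\<^sub>R v)) has_real_derivative \<psi> v t) (at t)" if "\<bar>t\<bar> < r / (norm v + 1)" for t v
    unfolding \<psi>_def by (rule has_real_derivative_along_line[OF d[OF near[OF that]]])
  have \<psi>0: "\<psi> v 0 = 0" for v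
  proof (rule DERIV_local_max[OF der])
    show "0 < r / (norm v + 1)" "\<bar>0::real\<bar> < r / (norm v + 1)"
      using r by (auto intro!: divide_pos_pos add_nonneg_pos)
    show "\<forall>y. \<bar>0 - y\<bar> < r / (norm v + 1) \<longrightarrow> f (x + y *\<^sub>R v) \<le> f (x + 0 *\<^sub>R v)"
      using near max by simp
  qed
  show "pderiv_at i f x = 0"
    using \<psi>0[of "axis i 1"] by (simp add: \<psi>_def axis_def if_distrib[of "\<lambda>u. u * c" for c] cong: if_cong)
  show "(\<Sum>i\<in>UNIV. \<Sum>j\<in>UNIV. pderiv_at j (pderiv_at i f) x * v i * v j) \<le> 0" (is "?l \<le> 0")
  proof (rule ccontr)
    assume "\<not> ?l \<le> 0"
    then have l: "?l > 0" by simp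
    define w where "w = (\<chi> i. v i)"
    have "(pderiv_at i f) differentiable (at (x + 0 *\<^sub>R w))" for i using d2[of i] by simp
    then have "((\<lambda>t. \<Sum>i\<in>UNIV. w $ i * pderiv_at i f (x + t *\<^sub>R w)) has_real_derivative
        (\<Sum>i\<in>UNIV. w $ i * (\<Sum>j\<in>UNIV. w $ j * pderiv_at j (pderiv_at i f) (x + 0 *\<^sub>R w)))) (at 0)"
      by (intro DERIV_sum DERIV_cmult has_real_derivative_along_line)
    then have "(\<psi> w has_real_derivative (\<Sum>i\<in>UNIV. w $ i * (\<Sum>j\<in>UNIV. w $ j * pderiv_at j (pderiv_at i f) (x + 0 *\<^sub>R w)))) (at 0)"
      by (simp only: \<psi>_def[abs_def])
    also have "(\<Sum>i\<in>UNIV. w $ i * (\<Sum>j\<in>UNIV. w $ j * pderiv_at j (pderiv_at i f) (x + 0 *\<^sub>R w))) = ?l"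
      by (simp add: w_def sum_distrib_left mult_ac)
    finally obtain e where e: "e > 0" "\<And>h. 0 < h \<Longrightarrow> h < e \<Longrightarrow> \<psi> w 0 < \<psi> w (0 + h)"
      using DERIV_pos_inc_right[OF _ l] by blast
    define e' where "e' = r / (norm w + 1)"
    define h where "h = min e e' / 2"
    have "e' > 0" using r unfolding e'_def by (auto intro!: divide_pos_pos add_nonneg_pos)
    then have "0 < h" "h < e" "h < e'" using e(1) by (auto simp: h_def min_def)
    then have h: "0 < h" "h < e" "h < r / (norm w + 1)" by (auto simp: e'_def)
    obtain t where t: "0 < t" "t < h" "f (x + h *\<^sub>R w) - f (x + 0 *\<^sub>R w) = (h - 0) * \<psi> w t"
      using MVT2[of 0 h "\<lambda>s. f (x + s *\<^sub>R w)" "\<psi> w"] der[of _ w] h by auto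
    have "\<psi> w t > 0" using e(2)[of t] t h \<psi>0 by simp
    then have "f (x + h *\<^sub>R w) > f x" using t(3) mult_pos_pos[OF h(1), of "\<psi> w t"] by simp
    moreover have "f (x + h *\<^sub>R w) \<le> f x" using near[of h w] h max by simp
    ultimately show False by simp
  qed
qed

text \<open>There is no term of order zero, so constants are in the kernel. The Laplace-Beltrami
  operator has this form in a chart, with \<open>a\<close> the inverse metric and \<open>b\<close>
  the field \<open>drift\<close> defined below.\<close>

definition elliptic_op ::
  "(real^'n::finite \<Rightarrow> 'n \<Rightarrow> 'n \<Rightarrow> real) \<Rightarrow> (real^'n \<Rightarrow> 'n \<Rightarrow> real) \<Rightarrow> (real^'n \<Rightarrow> real) \<Rightarrow> real^'n \<Rightarrow> real" where
  "elliptic_op a b u x = (\<Sum>i\<in>UNIV. \<Sum>j\<in>UNIV. a x i j * pderiv_at j (pderiv_at i u) x) +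
     (\<Sum>i\<in>UNIV. b x i * pderiv_at i u x)"

text \<open>At a maximum the gradient vanishes, and what remains pairs a positive definite matrix
  with a negative semidefinite Hessian.\<close>

lemma elliptic_op_local_max:
  fixes u :: "real^'n \<Rightarrow> real"
  assumes sym: "\<And>i j. a x i j = a x j i"
    and pos: "\<And>v. (\<exists>i. v i \<noteq> 0) \<Longrightarrow> 0 < (\<Sum>i\<in>UNIV. \<Sum>j\<in>UNIV. a x i j * v i * v j)"
    and r: "r > 0" and max: "\<And>y. y \<in> ball x r \<Longrightarrow> u y \<le> u x"
    and d: "\<And>y. y \<in> ball x r \<Longrightarrow> u differentiable (at y)"
    and d2: "\<And>i. (\<lambda>y. pderiv_at i u y) differentiable (at x)"
  shows "elliptic_op a b u x \<le> 0"
proof -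
  have "0 \<le> (\<Sum>i\<in>UNIV. \<Sum>j\<in>UNIV. a x i j * (- pderiv_at j (pderiv_at i u) x))"
  proof (rule sum_pos_def_mult_nonneg)
    show "0 \<le> (\<Sum>i\<in>UNIV. \<Sum>j\<in>UNIV. - pderiv_at j (pderiv_at i u) x * v i * v j)" for v
      using local_max_derivatives(2)[OF r max d d2, of v] by (simp add: sum_negf)
  qed (use sym pos in auto)
  then show ?thesis
    using local_max_derivatives(1)[OF r max d d2] by (simp add: elliptic_op_def sum_negf)
qed

lemma elliptic_op_add_cmult:
  fixes u w :: "real^'n \<Rightarrow> real"
  assumes U: "open U" "x \<in> U"
    and "\<And>y. y \<in> U \<Longrightarrow> u differentiable (at y)" "\<And>i. (\<lambda>y. pderiv_at i u y) differentiable (at x)"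
    and "\<And>y. y \<in> U \<Longrightarrow> w differentiable (at y)" "\<And>i. (\<lambda>y. pderiv_at i w y) differentiable (at x)"
  shows "(\<lambda>y. pderiv_at i (\<lambda>y. u y + c * w y) y) differentiable (at x)"
    and "elliptic_op a b (\<lambda>y. u y + c * w y) x = elliptic_op a b u x + c * elliptic_op a b w x"
proof -
  have 1: "pderiv_at i (\<lambda>y. u y + c * w y) y = pderiv_at i u y + c * pderiv_at i w y" if "y \<in> U" for y i
    using assms that by (simp add: pderiv_at_add pderiv_at_cmult)
  show "(\<lambda>y. pderiv_at i (\<lambda>y. u y + c * w y) y) differentiable (at x)" for i
    by (rule differentiable_cong_open[of "\<lambda>y. pderiv_at i u y + c * pderiv_at i w y", OF _ U])
      (use assms 1 in \<open>auto intro!: differentiable_add differentiable_mult\<close>)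
  have 2: "pderiv_at j (pderiv_at i (\<lambda>y. u y + c * w y)) x = pderiv_at j (pderiv_at i u) x + c * pderiv_at j (pderiv_at i w) x" for i j
    using pderiv_at_cong[OF U, of "pderiv_at i (\<lambda>y. u y + c * w y)" "\<lambda>y. pderiv_at i u y + c * pderiv_at i w y"] 1 assms
    by (simp add: pderiv_at_add pderiv_at_cmult)
  show "elliptic_op a b (\<lambda>y. u y + c * w y) x = elliptic_op a b u x + c * elliptic_op a b w x"
    unfolding elliptic_op_def 1[OF U(2)] 2
    by (simp add: distrib_left sum.distrib sum_distrib_left mult_ac)
qed

text \<open>The Gaussian about \<open>z\<close> is Hopf's barrier: the term quadratic in
  \<open>k\<close> is the form of \<open>a\<close> at \<open>x - z\<close>, so where
  \<open>a\<close> is positive definite it dominates for large \<open>k\<close> at any point other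
  than \<open>z\<close>.\<close>

lemma
  fixes z :: "real^'n" and k :: real
  defines "w \<equiv> (\<lambda>x. exp (- k * ((x - z) \<bullet> (x - z))))"
  shows barrier_differentiable: "w differentiable (at x)"
    and pderiv_barrier: "pderiv_at i w = (\<lambda>x. - 2 * k * (x - z) $ i * w x)"
    and pderiv_barrier_differentiable: "(\<lambda>y. pderiv_at i w y) differentiable (at x)"
    and elliptic_op_barrier: "elliptic_op a b w x = w x * (4 * k * k * (\<Sum>i\<in>UNIV. \<Sum>j\<in>UNIV. a x i j * (x - z) $ i * (x - z) $ j)
       - 2 * k * ((\<Sum>i\<in>UNIV. a x i i) + (\<Sum>i\<in>UNIV. b x i * (x - z) $ i)))"
proof -
  have w: "(w has_derivative (\<lambda>v. - 2 * k * ((x - z) \<bullet> v) * w x)) (at x)" for x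
    unfolding w_def by (auto intro!: derivative_eq_intros simp: inner_commute algebra_simps)
  then show "w differentiable (at x)" by (auto simp: differentiable_def)
  show p: "pderiv_at i w = (\<lambda>x. - 2 * k * (x - z) $ i * w x)" for i
    using pderiv_at_eq[OF w] by (auto simp: inner_axis)
  have c: "((\<lambda>x. (x - z) $ i) has_derivative (\<lambda>v. v $ i)) (at x)" for i x
    using has_derivative_diff[OF bounded_linear.has_derivative[OF bounded_linear_vec_nth has_derivative_ident] has_derivative_const]
    by simp
  have dp: "((\<lambda>x. - 2 * k * (x - z) $ i * w x) has_derivative
     (\<lambda>v. - 2 * k * (x - z) $ i * (- 2 * k * ((x - z) \<bullet> v) * w x) + - 2 * k * v $ i * w x)) (at x)" for i
    by (rule has_derivative_mult[OF has_derivative_mult_right[OF c] w])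
  then show "(\<lambda>y. pderiv_at i w y) differentiable (at x)"
    unfolding p by (auto simp: differentiable_def)
  have ax: "(axis j 1 :: real^'n) $ i = (if i = j then 1 else 0)" for i j by (simp add: axis_def)
  have p2: "pderiv_at j (pderiv_at i w) x = 4 * k * k * (x - z) $ i * (x - z) $ j * w x - (if i = j then 2 * k * w x else 0)" for i j
    unfolding p pderiv_at_eq[OF dp] by (simp add: inner_axis ax algebra_simps)
  have t: "(\<Sum>j\<in>UNIV. a x i j * (if i = j then 2 * k * w x else 0)) = a x i i * (2 * k * w x)" for i
    by (simp add: if_distrib cong: if_cong)
  show "elliptic_op a b w x = w x * (4 * k * k * (\<Sum>i\<in>UNIV. \<Sum>j\<in>UNIV. a x i j * (x - z) $ i * (x - z) $ j)
       - 2 * k * ((\<Sum>i\<in>UNIV. a x i i) + (\<Sum>i\<in>UNIV. b x i * (x - z) $ i)))"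
  proof -
    have "(\<Sum>i\<in>UNIV. \<Sum>j\<in>UNIV. a x i j * (4 * k * k * (x - z) $ i * (x - z) $ j * w x)) =
        w x * (4 * k * k * (\<Sum>i\<in>UNIV. \<Sum>j\<in>UNIV. a x i j * (x - z) $ i * (x - z) $ j))"
      unfolding sum_distrib_left by (intro sum.cong refl) (simp only: mult_ac)
    moreover have "(\<Sum>i\<in>UNIV. a x i i * (2 * k * w x)) = w x * (2 * k * (\<Sum>i\<in>UNIV. a x i i))"
      by (simp add: sum_distrib_left mult_ac)
    moreover have "(\<Sum>i\<in>UNIV. b x i * (- 2 * k * (x - z) $ i * w x)) = - (w x * (2 * k * (\<Sum>i\<in>UNIV. b x i * (x - z) $ i)))"
      by (simp add: sum_distrib_left sum_negf mult_ac)
    ultimately show ?thesis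
      unfolding elliptic_op_def p2 unfolding p right_diff_distrib sum_subtractf t distrib_left by linarith
  qed
qed

text \<open>The ball with diameter from \<open>y\<close> to \<open>z\<close> lies in the ball about
  \<open>y\<close> through \<open>z\<close> and meets its boundary only at \<open>z\<close>. With
  the midpoint as origin this is the parallelogram law for \<open>p\<close> and \<open>q\<close>, as
  \<open>p + q = x - y\<close> and \<open>p - q = x - z\<close>.\<close>

lemma interior_contact:
  fixes y z :: "'a::real_inner"
  assumes "dist (midpoint y z) x \<le> dist y z / 2" "dist y z \<le> dist y x"
  shows "x = z"
proof -
  define p q where "p = x - midpoint y z" and "q = midpoint y z - y"
  have z: "z - midpoint y z = q" unfolding q_def by (simp add: midpoint_def algebra_simps) (simp flip: scaleR_add_left)
  have "norm p = dist (midpoint y z) x" "norm q = dist y (midpoint y z)" "norm (p + q) = dist y x"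
    unfolding p_def q_def dist_norm by (simp_all add: norm_minus_commute)
  then have "norm p \<le> norm q" and "2 * norm q \<le> norm (p + q)"
    using assms by (simp_all add: dist_midpoint)
  then have "norm p ^ 2 \<le> norm q ^ 2" "4 * norm q ^ 2 \<le> norm (p + q) ^ 2"
    using power_mono[of "norm p" "norm q" 2] power_mono[of "2 * norm q" "norm (p + q)" 2]
    by (simp_all add: power_mult_distrib)
  moreover have "norm (p - q) ^ 2 = 2 * norm p ^ 2 + 2 * norm q ^ 2 - norm (p + q) ^ 2"
    by (simp add: power2_norm_eq_inner inner_diff_left inner_diff_right inner_add_left inner_add_right inner_commute)
  ultimately have "norm (p - q) ^ 2 \<le> 0" by linarith
  then have "p = q" by simp
  then have "x - midpoint y z = z - midpoint y z" using z by (simp only: p_def)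
  then show ?thesis by simp
qed

text \<open>Hopf's argument: a ball inside \<open>{u < u x0}\<close> that touches the contact set in a single point
  \<open>z\<close> carries a barrier, and adding a small multiple of it to \<open>u\<close> creates an interior maximum near
  \<open>z\<close> at which the operator is positive.\<close>

lemma strong_maximum_principle:
  fixes u :: "real^'n \<Rightarrow> real"
  assumes U: "open U" "x0 \<in> U"
    and d: "\<And>x. x \<in> U \<Longrightarrow> u differentiable (at x)"
    and d2: "\<And>x i. x \<in> U \<Longrightarrow> (\<lambda>y. pderiv_at i u y) differentiable (at x)"
    and a: "\<And>i j. continuous_on U (\<lambda>x. a x i j)" and b: "\<And>i. continuous_on U (\<lambda>x. b x i)"
    and sym: "\<And>x i j. x \<in> U \<Longrightarrow> a x i j = a x j i"
    and pos: "\<And>x v. x \<in> U \<Longrightarrow> (\<exists>i. v i \<noteq> 0) \<Longrightarrow> 0 < (\<Sum>i\<in>UNIV. \<Sum>j\<in>UNIV. a x i j * v i * v j)"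
    and L: "\<And>x. x \<in> U \<Longrightarrow> elliptic_op a b u x \<ge> 0"
    and max: "\<And>x. x \<in> U \<Longrightarrow> u x \<le> u x0"
  shows "\<exists>e>0. \<forall>x\<in>ball x0 e. u x = u x0"
proof (rule ccontr)
  assume contr: "\<not> ?thesis"
  have cu: "continuous_on U u"
    using d differentiable_imp_continuous_within continuous_at_imp_continuous_on by blast
  obtain r' where "r' > 0" "cball x0 r' \<subseteq> U" using U open_contains_cball by blast
  \<comment> \<open>\<open>y\<close> will be within \<open>r\<close> of \<open>x0\<close>, and its
    nearest contact point within \<open>r\<close> of \<open>y\<close>, so the construction stays
    within \<open>2 * r\<close> of \<open>x0\<close>.\<close>
  then obtain r where r: "r > 0" "cball x0 (2 * r) \<subseteq> U" by (metis half_gt_zero nonzero_mult_div_cancel_left zero_neq_numeral times_divide_eq_right)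
  define Z where "Z = {x \<in> cball x0 (2 * r). u x = u x0}"
  obtain y where y: "dist x0 y < r" "u y \<noteq> u x0" using contr r by auto
  have "closed Z"
    unfolding Z_def using continuous_closed_preimage_constant[of "cball x0 (2 * r)" u] continuous_on_subset[OF cu r(2)] by auto
  moreover have "x0 \<in> Z" using r by (simp add: Z_def)
  ultimately obtain z where z: "z \<in> Z" and zmin: "\<And>x. x \<in> Z \<Longrightarrow> dist y z \<le> dist y x"
    using distance_attains_inf[of Z y] by blast
  have yz: "dist y z < r" using zmin[OF \<open>x0 \<in> Z\<close>] y by (simp add: dist_commute)
  \<comment> \<open>The ball about \<open>y\<close> through \<open>z\<close> has no contact point in
    its interior but may touch several; the ball of half the radius about \<open>c\<close> touches
    only \<open>z\<close>.\<close>
  define c R where "c = midpoint y z" and "R = dist y z / 2"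
  have uz: "u z = u x0" using z by (simp add: Z_def)
  then have "y \<noteq> z" using y by auto
  then have R: "R > 0" by (simp add: R_def)
  have cz: "dist c z = R" by (simp add: c_def R_def dist_midpoint)
  have cy: "dist y c = R" by (simp add: c_def R_def dist_midpoint)
  have inside: "u x < u x0" if "dist c x \<le> R" "x \<noteq> z" for x
  proof -
    have "dist x0 x \<le> dist x0 y + (dist y c + dist c x)"
      using dist_triangle[of x0 x y] dist_triangle[of y x c] by linarith
    then have xc: "x \<in> cball x0 (2 * r)" using that y yz cy by (simp add: R_def)
    moreover have "x \<notin> Z" using interior_contact[of y z x] that zmin[of x] by (auto simp: c_def R_def)
    ultimately show ?thesis using max[of x] r(2) by (auto simp: Z_def less_le)
  qed
  have zr: "dist x0 z < 2 * r" using dist_triangle[of x0 z y] y yz by linarith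
  then have zU: "z \<in> U" using r(2) by auto
  define Q where "Q = (\<Sum>i\<in>UNIV. \<Sum>j\<in>UNIV. a z i j * (z - c) $ i * (z - c) $ j)"
  define B where "B = (\<Sum>i\<in>UNIV. a z i i) + (\<Sum>i\<in>UNIV. b z i * (z - c) $ i)"
  have "z - c \<noteq> 0" using cz R by auto
  then have Q: "Q > 0" unfolding Q_def
    by (intro pos[OF zU]) (simp add: vec_eq_iff)
  \<comment> \<open>Makes \<open>2 * (k * Q) - B\<close>, which decides the sign of the operator on
    the barrier at \<open>z\<close>, equal to \<open>2 * \<bar>B\<bar> + 2 - B > 0\<close>.\<close>
  define k where "k = (\<bar>B\<bar> + 1) / Q"
  have k: "k > 0" "k * Q = \<bar>B\<bar> + 1" using Q by (auto simp: k_def)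
  define w where "w = (\<lambda>x. exp (- k * ((x - c) \<bullet> (x - c))))"
  note w_diff = barrier_differentiable[where k = k and z = c, folded w_def]
    and w_diff2 = pderiv_barrier_differentiable[where k = k and z = c, folded w_def]
    and w_op = elliptic_op_barrier[where k = k and z = c and a = a and b = b, folded w_def]
  have "4 * k * k * Q - 2 * k * B = 2 * k * (2 * (k * Q) - B)" by (simp add: algebra_simps)
  also have "\<dots> > 0" using k by (intro mult_pos_pos) auto
  finally have Lwz: "elliptic_op a b w z > 0"
    unfolding w_op Q_def[symmetric] B_def[symmetric] by (simp add: w_def)
  have "continuous_on U (elliptic_op a b w)"
  proof -
    have "continuous_on U w" unfolding w_def by (intro continuous_intros)
    then show ?thesis
      unfolding w_op[abs_def] by (intro continuous_intros a b)
  qed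
  then have "isCont (elliptic_op a b w) z" using U zU by (simp add: continuous_on_eq_continuous_at)
  then obtain s1 where s1: "s1 > 0" "\<And>x. dist z x < s1 \<Longrightarrow> elliptic_op a b w x > 0"
    using continuous_at_avoid Lwz
    unfolding continuous_at_eps_delta dist_real_def by (metis abs_diff_less_iff cancel_comm_monoid_add_class.diff_cancel dist_commute)
  define s where "s = min s1 (2 * r - dist x0 z) / 2"
  have s: "s > 0" "s < s1" "dist x0 z + s < 2 * r" using s1 zr by (auto simp: s_def min_def field_simps)
  have sub: "cball z s \<subseteq> U"
  proof
    fix x assume "x \<in> cball z s"
    then have "dist x0 x \<le> 2 * r" using dist_triangle[of x0 x z] s by simp
    then show "x \<in> U" using r(2) by auto
  qed
  \<comment> \<open>The part of the sphere about \<open>z\<close> where the barrier may exceed its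
    value at \<open>z\<close>. It is compact and avoids \<open>z\<close>, so \<open>u\<close> stays
    below its maximum there by a fixed \<open>e\<close>.\<close>
  define T where "T = sphere z s \<inter> cball c R"
  have T: "compact T" unfolding T_def by (intro compact_Int_closed) auto
  have Tlt: "u x < u x0" if "x \<in> T" for x using that inside[of x] s by (auto simp: T_def)
  obtain e where e: "e > 0" "\<And>x. x \<in> T \<Longrightarrow> u x + e \<le> u x0"
  proof (cases "T = {}")
    case True
    then show thesis using that[of 1] by auto
  next
    case False
    have "continuous_on T u" by (rule continuous_on_subset[OF cu]) (use sub in \<open>auto simp: T_def\<close>)
    then obtain x1 where "x1 \<in> T" "\<And>x. x \<in> T \<Longrightarrow> u x \<le> u x1"
      using continuous_attains_sup[OF T False] by blast
    then show thesis using that[of "u x0 - u x1"] Tlt[of x1] by force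
  qed
  define w' where "w' = exp (- k * (R * R))"
  define h where "h x = u x + e * w x" for x
  have inner_dist: "(x - c) \<bullet> (x - c) = dist c x * dist c x" for x
    unfolding dist_norm norm_minus_commute[of c] by (simp flip: power2_norm_eq_inner power2_eq_square)
  have wle: "w x \<le> w'" if "dist c x \<ge> R" for x
  proof -
    have "R * R \<le> (x - c) \<bullet> (x - c)"
      using mult_mono[OF that that] R unfolding inner_dist by simp
    then show ?thesis using k by (simp add: w_def w'_def)
  qed
  have wz: "w z = w'"
    unfolding w_def w'_def inner_dist cz ..
  have w1: "w x \<le> 1" for x using k by (simp add: w_def)
  have w'0: "w' > 0" by (simp add: w'_def)
  \<comment> \<open>Within distance \<open>R\<close> of \<open>c\<close> the gap \<open>e\<close>
    absorbs the barrier, which is at most \<open>1\<close>; farther out neither \<open>u\<close> nor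
    the barrier exceeds its value at \<open>z\<close>.\<close>
  have bdry: "h x \<le> h z" if "dist z x = s" for x
  proof (cases "dist c x \<le> R")
    case True
    then have "u x + e \<le> u x0" using e that by (auto simp: T_def)
    moreover have "e * w x \<le> e * 1" using w1 e by (intro mult_left_mono) auto
    moreover have "0 \<le> e * w'" using e w'0 by simp
    ultimately show ?thesis by (simp add: h_def uz wz)
  next
    case False
    then have "e * w x \<le> e * w'" using wle e by (intro mult_left_mono) auto
    moreover have "u x \<le> u x0" using sub that by (intro max) auto
    ultimately show ?thesis by (simp add: h_def uz wz)
  qed
  have "continuous_on (cball z s) h"
    unfolding h_def w_def by (intro continuous_intros continuous_on_subset[OF cu sub])
  then obtain p where p: "p \<in> cball z s" "\<And>x. x \<in> cball z s \<Longrightarrow> h x \<le> h p"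
    using continuous_attains_sup[of "cball z s" h] s by auto
  \<comment> \<open>If the maximum is attained on the bounding sphere, \<open>bdry\<close> shows
    that \<open>z\<close> attains it as well; thus \<open>q\<close> is interior in either
    case.\<close>
  define q where "q = (if dist z p = s then z else p)"
  have q: "dist z q < s" "\<And>x. x \<in> cball z s \<Longrightarrow> h x \<le> h q"
    using p bdry[of p] s by (force simp: q_def)+
  have qU: "q \<in> U" using q sub by auto
  have ball: "x \<in> cball z s" if "x \<in> ball q (s - dist z q)" for x
    using that dist_triangle[of z x q] by simp
  have hd: "\<And>x. x \<in> U \<Longrightarrow> h differentiable (at x)"
    unfolding h_def using d w_diff by (intro differentiable_add differentiable_mult) auto
  have hop: "(\<lambda>y. pderiv_at i h y) differentiable (at q)"
    "elliptic_op a b h q = elliptic_op a b u q + e * elliptic_op a b w q" for i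
    unfolding h_def by (intro elliptic_op_add_cmult[OF U(1) qU d d2 w_diff w_diff2] qU; assumption)+
  have "elliptic_op a b h q \<le> 0"
  proof (rule elliptic_op_local_max[of a q "s - dist z q" h b])
    show "a q i j = a q j i" for i j by (rule sym[OF qU])
    show "0 < (\<Sum>i\<in>UNIV. \<Sum>j\<in>UNIV. a q i j * v i * v j)" if "\<exists>i. v i \<noteq> 0" for v
      by (rule pos[OF qU that])
    show "s - dist z q > 0" using q by simp
    show "h y \<le> h q" "h differentiable (at y)" if "y \<in> ball q (s - dist z q)" for y
      using q(2)[OF ball[OF that]] hd[of y] sub ball[OF that] by auto
  qed (rule hop)
  moreover have "elliptic_op a b u q \<ge> 0" "elliptic_op a b w q > 0"
    using L[OF qU] s1(2)[of q] q(1) s by auto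
  then have "elliptic_op a b u q + e * elliptic_op a b w q > 0"
    using e by (simp add: add_nonneg_pos)
  ultimately show False using hop by simp
qed

section \<open>Smooth functions and the Codazzi equation\<close>

lemma
  assumes "smooth_on S f" 
  shows smooth_on_imp_continuous_on: "continuous_on S f"
    and smooth_on_imp_differentiable: "x \<in> S \<Longrightarrow> f differentiable (at x)"
    and smooth_on_frechet: "smooth_on S (\<lambda>x. frechet_derivative f (at x) v)"
proof -
  have k: "k_differentiable_on k S f" for k using assms by (simp add: smooth_on_def)
  show "continuous_on S f" using k[of 0] by simp
  show "x \<in> S \<Longrightarrow> f differentiable (at x)" using k[of 1] by simp
  show "smooth_on S (\<lambda>x. frechet_derivative f (at x) v)"
    unfolding smooth_on_def using k[of "Suc k" for k] by simp
qed

lemma smooth_on_pderiv_at: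
  assumes "smooth_on S f"
  shows "smooth_on S (pderiv_at i f)"
  using smooth_on_frechet[OF assms, of "axis i 1"] by (simp add: pderiv_at_def[abs_def])

lemma pderiv_at_commute_smooth:
  assumes "open U" "x \<in> U" "smooth_on U f"
  shows "pderiv_at j (pderiv_at i f) x = pderiv_at i (pderiv_at j f) x"
  using assms
  by (intro pderiv_at_commute[of U] smooth_on_imp_differentiable smooth_on_imp_continuous_on smooth_on_pderiv_at)

text \<open>In affine coordinates both sides are the same third derivative of the potential
  \<open>h\<close>. In arbitrary coordinates there are further terms with \<open>\<Gamma>\<close>
  and its derivatives; vanishing torsion and curvature cancel those that are not symmetric in
  \<open>k\<close> and \<open>i\<close>.\<close>

lemma hessian_metric_codazzi:
  fixes \<Gamma> :: "'n::finite local_conn" and \<gamma> :: "'n local_metric"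
  assumes V: "open V" "x \<in> V" and h: "smooth_on V h"
    and hess: "\<And>y i j. y \<in> V \<Longrightarrow> \<gamma> y $ i $ j = hess \<Gamma> h y i j"
    and d: "\<And>k i j. (\<lambda>y. \<Gamma> y k i j) differentiable (at x)"
    and sym: "\<And>k i j. \<Gamma> x k i j = \<Gamma> x k j i"
    and flat: "\<And>l i j k. curvature \<Gamma> x l i j k = 0"
  shows "pderiv_at k (\<lambda>y. \<gamma> y $ i $ j) x - (\<Sum>l\<in>UNIV. \<Gamma> x l k i * \<gamma> x $ l $ j + \<Gamma> x l k j * \<gamma> x $ i $ l) =
         pderiv_at i (\<lambda>y. \<gamma> y $ k $ j) x - (\<Sum>l\<in>UNIV. \<Gamma> x l i k * \<gamma> x $ l $ j + \<Gamma> x l i j * \<gamma> x $ k $ l)"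
proof -
  define p where "p m = pderiv_at m h x" for m
  define P where "P k m = pderiv_at k (pderiv_at m h) x" for k m
  define P3 where "P3 k i j = pderiv_at k (pderiv_at i (pderiv_at j h)) x" for k i j
  define dG where "dG k l i j = pderiv_at k (\<lambda>y. \<Gamma> y l i j) x" for k l i j
  have P3: "P3 k i j = P3 i k j" for k i j
    unfolding P3_def by (rule pderiv_at_commute_smooth[OF V smooth_on_pderiv_at[OF h]])
  note sd = smooth_on_imp_differentiable[OF smooth_on_pderiv_at[OF h] V(2)]
    smooth_on_imp_differentiable[OF smooth_on_pderiv_at[OF smooth_on_pderiv_at[OF h]] V(2)]
  have \<gamma>: "\<gamma> y $ i $ j = pderiv_at i (pderiv_at j h) y - (\<Sum>m\<in>UNIV. \<Gamma> y m i j * pderiv_at m h y)"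
    if "y \<in> V" for y i j
    using hess[OF that] by (simp add: hess_def cov_deriv_form_def)
  have \<gamma>x: "\<gamma> x $ i $ j = P i j - (\<Sum>m\<in>UNIV. \<Gamma> x m i j * p m)" for i j
    using \<gamma>[OF V(2)] by (simp add: P_def p_def)
  have d\<gamma>: "pderiv_at k (\<lambda>y. \<gamma> y $ i $ j) x =
      P3 k i j - (\<Sum>m\<in>UNIV. \<Gamma> x m i j * P k m) - (\<Sum>m\<in>UNIV. dG k m i j * p m)" for k i j
  proof -
    have "pderiv_at k (\<lambda>y. \<gamma> y $ i $ j) x =
        pderiv_at k (\<lambda>y. pderiv_at i (pderiv_at j h) y - (\<Sum>m\<in>UNIV. \<Gamma> y m i j * pderiv_at m h y)) x"
      by (rule pderiv_at_cong[OF V \<gamma>])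
    also have "\<dots> = P3 k i j - (\<Sum>m\<in>UNIV. \<Gamma> x m i j * P k m + dG k m i j * p m)"
      using sd d by (subst pderiv_at_diff) (auto intro!: differentiable_sum' differentiable_mult
        simp: pderiv_at_sum pderiv_at_mult P3_def P_def dG_def p_def)
    finally show ?thesis by (simp add: sum.distrib)
  qed
  \<comment> \<open>Derivatives of \<open>\<Gamma>\<close> enter only antisymmetrised in
    \<open>k\<close> and \<open>i\<close>. Flatness turns them into products of Christoffel symbols,
    which match the products in \<open>s1\<close> and \<open>s2\<close>.\<close>
  have curv: "dG k m i j - dG i m k j = (\<Sum>l\<in>UNIV. \<Gamma> x m i l * \<Gamma> x l k j) - (\<Sum>l\<in>UNIV. \<Gamma> x m k l * \<Gamma> x l i j)" for m
    using flat[of m k i j] by (simp add: curvature_def dG_def sum_subtractf)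
  have "(\<Sum>m\<in>UNIV. dG k m i j * p m) - (\<Sum>m\<in>UNIV. dG i m k j * p m)
      = (\<Sum>m\<in>UNIV. ((\<Sum>l\<in>UNIV. \<Gamma> x m i l * \<Gamma> x l k j) - (\<Sum>l\<in>UNIV. \<Gamma> x m k l * \<Gamma> x l i j)) * p m)"
    unfolding curv[symmetric] by (simp add: left_diff_distrib sum_subtractf)
  also have "\<dots> = (\<Sum>m\<in>UNIV. \<Sum>l\<in>UNIV. \<Gamma> x l k j * (\<Gamma> x m i l * p m)) - (\<Sum>m\<in>UNIV. \<Sum>l\<in>UNIV. \<Gamma> x l i j * (\<Gamma> x m k l * p m))"
    by (simp add: left_diff_distrib right_diff_distrib sum_subtractf sum_distrib_left sum_distrib_right mult_ac)
  also have "\<dots> = (\<Sum>l\<in>UNIV. \<Gamma> x l k j * (\<Sum>m\<in>UNIV. \<Gamma> x m i l * p m)) - (\<Sum>l\<in>UNIV. \<Gamma> x l i j * (\<Sum>m\<in>UNIV. \<Gamma> x m k l * p m))"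
    unfolding sum_distrib_left by (intro arg_cong2[where f = minus] sum.swap)
  finally have *: "(\<Sum>m\<in>UNIV. dG k m i j * p m) - (\<Sum>m\<in>UNIV. dG i m k j * p m) = \<dots>" .
  have s1: "(\<Sum>l\<in>UNIV. \<Gamma> x l k j * \<gamma> x $ i $ l) = (\<Sum>l\<in>UNIV. \<Gamma> x l k j * P i l) - (\<Sum>l\<in>UNIV. \<Gamma> x l k j * (\<Sum>m\<in>UNIV. \<Gamma> x m i l * p m))"
    and s2: "(\<Sum>l\<in>UNIV. \<Gamma> x l i j * \<gamma> x $ k $ l) = (\<Sum>l\<in>UNIV. \<Gamma> x l i j * P k l) - (\<Sum>l\<in>UNIV. \<Gamma> x l i j * (\<Sum>m\<in>UNIV. \<Gamma> x m k l * p m))"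
    unfolding \<gamma>x by (simp_all add: right_diff_distrib sum_subtractf)
  have "(\<Sum>l\<in>UNIV. \<Gamma> x l k i * \<gamma> x $ l $ j) = (\<Sum>l\<in>UNIV. \<Gamma> x l i k * \<gamma> x $ l $ j)"
    by (simp only: sym[of _ k i])
  then show ?thesis
    unfolding d\<gamma> sum.distrib s1 s2 using * P3[of k i j] by linarith
qed

section \<open>Determinants\<close>

lemma pderiv_at_prod:
  fixes f :: "'i \<Rightarrow> real^'n \<Rightarrow> real"
  assumes "\<And>i. i \<in> I \<Longrightarrow> f i differentiable (at x)"
  shows "(\<lambda>y. \<Prod>i\<in>I. f i y) differentiable (at x)"
    and "pderiv_at k (\<lambda>y. \<Prod>i\<in>I. f i y) x = (\<Sum>i\<in>I. pderiv_at k (f i) x * (\<Prod>j\<in>I - {i}. f j x))"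
proof -
  have "((\<lambda>y. \<Prod>i\<in>I. f i y) has_derivative
      (\<lambda>v. \<Sum>i\<in>I. frechet_derivative (f i) (at x) v * (\<Prod>j\<in>I - {i}. f j x))) (at x)"
    by (rule has_derivative_prod) (use assms frechet_derivative_works in blast)
  from pderiv_at_eq[OF this, of k] this
  show "pderiv_at k (\<lambda>y. \<Prod>i\<in>I. f i y) x = (\<Sum>i\<in>I. pderiv_at k (f i) x * (\<Prod>j\<in>I - {i}. f j x))"
    "(\<lambda>y. \<Prod>i\<in>I. f i y) differentiable (at x)"
    by (auto simp: pderiv_at_def differentiable_def)
qed

text \<open>The differential of the determinant at \<open>A\<close> in direction \<open>X\<close>,
  expanded by rows.\<close>

definition det_deriv :: "real^'n^'n \<Rightarrow> real^'n^'n \<Rightarrow> real" where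
  "det_deriv A X = (\<Sum>i\<in>UNIV. det (\<chi> r. if r = i then X $ i else A $ r))"

lemma pderiv_at_det:
  fixes A :: "real^'n \<Rightarrow> real^'m^'m"
  assumes d: "\<And>i j. (\<lambda>y. A y $ i $ j) differentiable (at x)"
  shows "(\<lambda>y. det (A y)) differentiable (at x)"
    and "pderiv_at k (\<lambda>y. det (A y)) x = det_deriv (A x) (\<chi> i j. pderiv_at k (\<lambda>y. A y $ i $ j) x)"
proof -
  let ?P = "{p. p permutes (UNIV::'m set)}"
  have dp: "(\<lambda>y. \<Prod>i\<in>UNIV. A y $ i $ p i) differentiable (at x)" for p
    by (rule pderiv_at_prod) (rule d)
  show "(\<lambda>y. det (A y)) differentiable (at x)"
    unfolding det_def by (intro differentiable_sum' differentiable_mult dp) simp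
  have "pderiv_at k (\<lambda>y. det (A y)) x = (\<Sum>p\<in>?P. of_int (sign p) * pderiv_at k (\<lambda>y. \<Prod>i\<in>UNIV. A y $ i $ p i) x)"
    unfolding det_def using dp by (subst pderiv_at_sum) (auto intro!: differentiable_mult simp: pderiv_at_cmult)
  also have "\<dots> = (\<Sum>p\<in>?P. \<Sum>i\<in>UNIV. of_int (sign p) * (pderiv_at k (\<lambda>y. A y $ i $ p i) x * (\<Prod>j\<in>UNIV - {i}. A x $ j $ p j)))"
    unfolding pderiv_at_prod(2)[where f = "\<lambda>i y. A y $ i $ _ i", OF d] sum_distrib_left ..
  also have "\<dots> = (\<Sum>i\<in>UNIV. \<Sum>p\<in>?P. of_int (sign p) * (pderiv_at k (\<lambda>y. A y $ i $ p i) x * (\<Prod>j\<in>UNIV - {i}. A x $ j $ p j)))"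
    by (rule sum.swap)
  also have "\<dots> = det_deriv (A x) (\<chi> i j. pderiv_at k (\<lambda>y. A y $ i $ j) x)"
    unfolding det_deriv_def det_def
  proof (intro sum.cong refl arg_cong2[where f = times])
    fix i :: 'm and p
    show "pderiv_at k (\<lambda>y. A y $ i $ p i) x * (\<Prod>j\<in>UNIV - {i}. A x $ j $ p j) =
      (\<Prod>r\<in>UNIV. (\<chi> r. if r = i then (\<chi> i j. pderiv_at k (\<lambda>y. A y $ i $ j) x) $ i else A x $ r) $ r $ p r)"
      by (subst prod.remove[of UNIV i]) (auto intro!: arg_cong2[where f = times] prod.cong)
  qed
  finally show "pderiv_at k (\<lambda>y. det (A y)) x = det_deriv (A x) (\<chi> i j. pderiv_at k (\<lambda>y. A y $ i $ j) x)" .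
qed

lemma det_deriv_add: "det_deriv A (X + Y) = det_deriv A X + det_deriv A Y"
  unfolding det_deriv_def vector_add_component det_row_add[of _ "\<lambda>i. X $ i" for i] sum.distrib[symmetric]
  by (intro sum.cong refl) (rule det_row_add)

text \<open>Row \<open>i\<close> of \<open>B ** A\<close> is a combination of the rows of
  \<open>A\<close>; put in place of row \<open>i\<close>, only its component along that row, with
  coefficient \<open>B $ i $ i\<close>, affects the determinant.\<close>

lemma det_deriv_mult_left: "det_deriv A (B ** A) = trace B * det A"
proof -
  have "det (\<chi> r. if r = i then (B ** A) $ i else A $ r) = B $ i $ i * det A" for i
  proof -
    have "(\<chi> r. if r = i then (B ** A) $ i else A $ r) =
        (\<chi> r. if r = i then \<Sum>l\<in>UNIV. (B $ i) $ l *s row l A else row r A)"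
      by (simp add: vec_eq_iff matrix_matrix_mult_def row_def)
    then show ?thesis using cramer_lemma_transpose[of i "B $ i" A] by simp
  qed
  then show ?thesis by (simp add: det_deriv_def trace_def sum_distrib_right)
qed

text \<open>Both sides are derivatives at \<open>0\<close> along the line \<open>A + tX\<close> resp. its transpose.\<close>

lemma det_deriv_transpose:
  fixes A X :: "real^'n^'n"
  shows "det_deriv (transpose A) (transpose X) = det_deriv A X"
proof -
  fix k :: 'n
  have *: "pderiv_at k (\<lambda>y. det (A + (y $ k) *\<^sub>R X)) 0 = det_deriv A X" for A X :: "real^'n^'n"
  proof -
    have h: "((\<lambda>y. (A + (y $ k) *\<^sub>R X) $ i $ j) has_derivative (\<lambda>y. y $ k * X $ i $ j)) (at 0)" for i j
      using has_derivative_add[OF has_derivative_const has_derivative_mult_left[OF bounded_linear.has_derivative[OF bounded_linear_vec_nth has_derivative_ident]]]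
      by simp
    show ?thesis
      using pderiv_at_det(2)[of "\<lambda>y. A + (y $ k) *\<^sub>R X" 0 k] h pderiv_at_eq[OF h]
      by (force simp: differentiable_def)
  qed
  have "transpose A + t *\<^sub>R transpose X = transpose (A + t *\<^sub>R X)" for t
    by (simp add: transpose_def vec_eq_iff)
  then show ?thesis
    unfolding *[symmetric] by simp
qed

text \<open>Compatibility with the metric says that the derivative of \<open>A\<close> is
  \<open>B ** A\<close> plus its transpose, where \<open>B\<close> is the transpose of
  \<open>N\<close>. Both summands contribute \<open>trace B * det A\<close>, and no inverse of
  \<open>A\<close> appears.\<close>

lemma jacobi_formula_metric:
  fixes A :: "real^'n \<Rightarrow> real^'m^'m" and N :: "'m \<Rightarrow> 'm \<Rightarrow> real"
  assumes d: "\<And>i j. (\<lambda>y. A y $ i $ j) differentiable (at x)"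
    and sym: "\<And>i j. A x $ i $ j = A x $ j $ i"
    and dA: "\<And>i j. pderiv_at k (\<lambda>y. A y $ i $ j) x = (\<Sum>l\<in>UNIV. N l i * A x $ l $ j + N l j * A x $ i $ l)"
  shows "pderiv_at k (\<lambda>y. det (A y)) x = 2 * (\<Sum>i\<in>UNIV. N i i) * det (A x)"
proof -
  define B where "B = (\<chi> i l. N l i)"
  have tr: "transpose (A x) = A x" using sym by (simp add: transpose_def vec_eq_iff)
  have "(\<chi> i j. pderiv_at k (\<lambda>y. A y $ i $ j) x) = B ** A x + transpose (B ** A x)"
    unfolding dA by (simp add: vec_eq_iff B_def matrix_matrix_mult_def transpose_def sum.distrib sym[of _ ])
  then have "pderiv_at k (\<lambda>y. det (A y)) x = det_deriv (A x) (B ** A x) + det_deriv (A x) (transpose (B ** A x))"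
    by (simp add: pderiv_at_det(2)[OF d] det_deriv_add)
  also have "det_deriv (A x) (transpose (B ** A x)) = det_deriv (A x) (B ** A x)"
    using det_deriv_transpose[of "A x" "B ** A x"] tr by simp
  finally show ?thesis by (simp add: det_deriv_mult_left trace_def B_def)
qed

lemma pos_def_det_nonzero:
  fixes A :: "real^'n^'n"
  assumes "\<And>v. v \<noteq> 0 \<Longrightarrow> v \<bullet> (A *v v) > 0"
  shows "det A \<noteq> 0"
proof -
  have "v = 0" if "A *v v = 0" for v
    using assms[of v] that by (cases "v = 0") auto
  then have "\<exists>B. B ** A = mat 1" by (simp add: matrix_left_invertible_ker)
  then show ?thesis using invertible_det_nz invertible_left_inverse by blast
qed

section \<open>The inverse matrix and its differentiability\<close>

lemma matrix_inv_mult: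
  fixes A :: "real^'n^'n"
  assumes "det A \<noteq> 0"
  shows "A ** matrix_inv A = mat 1" "matrix_inv A ** A = mat 1"
proof -
  have "\<exists>B. A ** B = mat 1 \<and> B ** A = mat 1"
    using assms by (simp flip: invertible_det_nz add: invertible_def)
  then have "A ** matrix_inv A = mat 1 \<and> matrix_inv A ** A = mat 1"
    unfolding matrix_inv_def by (rule someI_ex)
  then show "A ** matrix_inv A = mat 1" "matrix_inv A ** A = mat 1" by auto
qed

text \<open>Exhibits the inverse as a quotient of determinants in the entries of \<open>A\<close>,
  from which its differentiability is read off.\<close>

lemma matrix_inv_cramer:
  fixes A :: "real^'n^'n"
  assumes "det A \<noteq> 0"
  shows "matrix_inv A $ i $ j = det (\<chi> r s. if s = i then (if r = j then 1 else 0) else A $ r $ s) / det A"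
proof -
  have "A ** matrix_inv A = mat 1"
    using assms by (rule matrix_inv_mult)
  then have "A *v (\<chi> s. matrix_inv A $ s $ j) = axis j 1"
    by (simp add: vec_eq_iff matrix_vector_mult_def matrix_matrix_mult_def mat_def axis_def)
  then have "(\<chi> s. matrix_inv A $ s $ j) = (\<chi> k. det (\<chi> r s. if s = k then axis j 1 $ r else A $ r $ s) / det A)"
    using cramer[OF assms] by blast
  then have "(\<chi> s. matrix_inv A $ s $ j) $ i = (\<chi> k. det (\<chi> r s. if s = k then axis j 1 $ r else A $ r $ s) / det A) $ i"
    by simp
  moreover have "axis j (1::real) $ r = (if r = j then 1 else 0)" for r by (simp add: axis_def)
  ultimately show ?thesis by (simp only: vec_lambda_beta)
qed

lemma matrix_inv_differentiable:
  fixes A :: "real^'n \<Rightarrow> real^'m^'m"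
  assumes U: "open U" "x \<in> U" and det: "\<And>y. y \<in> U \<Longrightarrow> det (A y) \<noteq> 0"
    and d: "\<And>i j. (\<lambda>y. A y $ i $ j) differentiable (at x)"
  shows "(\<lambda>y. matrix_inv (A y) $ i $ j) differentiable (at x)"
proof (rule differentiable_cong_open[OF _ U])
  show "(\<lambda>y. det (\<chi> r s. if s = i then (if r = j then 1 else 0) else A y $ r $ s) / det (A y)) differentiable (at x)"
  proof (intro differentiable_divide pderiv_at_det(1) d det U)
    show "(\<lambda>y. (\<chi> r s. if s = i then if r = j then 1 else 0 else A y $ r $ s) $ i' $ j') differentiable (at x)" for i' j'
      using d by (cases "j' = i") auto
  qed
qed (simp add: matrix_inv_cramer det)

section \<open>Koszul forms in coordinates\<close>

text \<open>On the coordinate frame, replacing the \<open>i\<close>-th vector picks out one diagonal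
  coefficient, so the connection terms add up to a trace of \<open>\<Gamma>\<close>.\<close>

lemma koszul1_eq:
  assumes "det (\<gamma> x) \<noteq> 0"
  shows "koszul1 \<Gamma> \<gamma> x k = pderiv_at k (\<lambda>y. sqrt (det (\<gamma> y))) x / sqrt (det (\<gamma> x)) - (\<Sum>i\<in>UNIV. \<Gamma> x i k i)"
proof -
  have one: "(\<chi> i. axis i 1) = (mat 1 :: real^'n^'n)" by (simp add: vec_eq_iff mat_def axis_def)
  have upd: "det (\<chi> r. ((\<lambda>i. axis i 1)(i := v)) r) = v $ i" for i and v :: "real^'n"
  proof -
    have "row l (mat 1 :: real^'n^'n) = axis l 1" for l by (simp add: row_def vec_eq_iff mat_def axis_def)
    then show ?thesis
      using cramer_lemma_transpose[of i v "mat 1"] basis_expansion[of v] by (simp add: fun_upd_def cong: if_cong)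
  qed
  have "det (\<chi> r. ((\<lambda>i. axis i 1)(i := (\<chi> l. \<Sum>j\<in>UNIV. \<Gamma> x l k j * axis i 1 $ j))) r) = \<Gamma> x i k i" for i
  proof -
    have "(\<Sum>j\<in>UNIV. \<Gamma> x i k j * axis i 1 $ j) = \<Gamma> x i k i"
      by (simp add: axis_def if_distrib cong: if_cong)
    then show ?thesis unfolding upd vec_lambda_beta .
  qed
  then show ?thesis
    using assms by (simp del: fun_upd_apply add: koszul1_def cov_deriv_top_def vol_form_def one diff_divide_distrib flip: sum_distrib_left)
qed

lemma pderiv_at_sqrt_log:
  assumes d: "f differentiable (at x)" and "f x \<noteq> 0"
  shows "pderiv_at k (\<lambda>y. sqrt (f y)) x / sqrt (f x) = pderiv_at k f x / (2 * f x)"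
proof -
  \<comment> \<open>\<open>sqrt\<close> is an odd function, hence the sign for negative arguments;
    this way a nonvanishing determinant is all that later uses have to supply.\<close>
  define c where "c = (if f x > 0 then 1 else -1) * inverse (sqrt (f x)) / 2"
  have "DERIV sqrt (f x) :> c"
    by (rule DERIV_real_sqrt_generic) (use assms in \<open>auto simp: c_def\<close>)
  then have "((\<lambda>y. sqrt (f y)) has_derivative (\<lambda>v. c * frechet_derivative f (at x) v)) (at x)"
    using has_derivative_compose[of f "frechet_derivative f (at x)" x UNIV sqrt "(*) c"] d
    by (simp add: has_field_derivative_def frechet_derivative_works)
  then have "pderiv_at k (\<lambda>y. sqrt (f y)) x = c * pderiv_at k f x"
    using pderiv_at_eq by (fastforce simp: pderiv_at_def)
  moreover have "c / sqrt (f x) = 1 / (2 * f x)"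
  proof -
    have "sqrt (f x) * sqrt (f x) = \<bar>f x\<bar>" by simp
    then show ?thesis using assms(2) by (auto simp: c_def divide_simps abs_if)
  qed
  ultimately show ?thesis by (metis (no_types, lifting) mult.commute mult_1 times_divide_eq_left times_divide_eq_right)
qed

section \<open>Local geometry of a Hessian metric\<close>

text \<open>\<open>N\<close> is the Levi-Civita connection of \<open>g\<close>, and \<open>D\<close> the flat connection; of the latter only
  the Codazzi equation is used.\<close>

locale codazzi_chart =
  fixes U :: "(real^'n::finite) set" and g :: "'n local_metric" and N D :: "'n local_conn"
  assumes open_U: "open U"
    and g_diff: "\<And>x i j. x \<in> U \<Longrightarrow> (\<lambda>y. g y $ i $ j) differentiable (at x)"
    and N_diff: "\<And>x k i j. x \<in> U \<Longrightarrow> (\<lambda>y. N y k i j) differentiable (at x)"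
    and D_diff: "\<And>x k i j. x \<in> U \<Longrightarrow> (\<lambda>y. D y k i j) differentiable (at x)"
    and g_sym: "\<And>x i j. x \<in> U \<Longrightarrow> g x $ i $ j = g x $ j $ i"
    and g_pos: "\<And>x v. x \<in> U \<Longrightarrow> v \<noteq> 0 \<Longrightarrow> v \<bullet> (g x *v v) > 0"
    and N_sym: "\<And>x k i j. x \<in> U \<Longrightarrow> N x k i j = N x k j i"
    and D_sym: "\<And>x k i j. x \<in> U \<Longrightarrow> D x k i j = D x k j i"
    and metric: "\<And>x k i j. x \<in> U \<Longrightarrow> pderiv_at k (\<lambda>y. g y $ i $ j) x =
        (\<Sum>l\<in>UNIV. N x l k i * g x $ l $ j + N x l k j * g x $ i $ l)"
    and codazzi: "\<And>x k i j. x \<in> U \<Longrightarrow>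
        pderiv_at k (\<lambda>y. g y $ i $ j) x - (\<Sum>l\<in>UNIV. D x l k i * g x $ l $ j + D x l k j * g x $ i $ l) =
        pderiv_at i (\<lambda>y. g y $ k $ j) x - (\<Sum>l\<in>UNIV. D x l i k * g x $ l $ j + D x l i j * g x $ k $ l)"
begin

text \<open>The first Koszul form of \<open>D\<close> (see \<open>koszul1_alpha\<close>), written as
  a trace of \<gamma> and so free of determinants and roots.\<close>

definition alpha :: "real^'n \<Rightarrow> 'n \<Rightarrow> real" where
  "alpha x k = (\<Sum>i\<in>UNIV. N x i k i - D x i k i)"

definition dual :: "'n local_conn" where
  "dual x k i j = 2 * N x k i j - D x k i j"

definition h :: "real^'n \<Rightarrow> 'n \<Rightarrow> 'n \<Rightarrow> real" where
  "h x i j = matrix_inv (g x) $ i $ j"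

definition sharp :: "real^'n \<Rightarrow> 'n \<Rightarrow> real" where
  "sharp x i = (\<Sum>j\<in>UNIV. h x i j * alpha x j)"

definition sqnorm :: "real^'n \<Rightarrow> real" where
  "sqnorm x = (\<Sum>i\<in>UNIV. alpha x i * sharp x i)"

text \<open>First-order coefficients of the Laplace-Beltrami operator, whose value on
  \<open>u\<close> is the contraction of \<open>h\<close> with \<open>hess N u\<close>.\<close>

definition drift :: "real^'n \<Rightarrow> 'n \<Rightarrow> real" where
  "drift x k = - (\<Sum>i\<in>UNIV. \<Sum>j\<in>UNIV. h x i j * N x k i j)"

lemma det_nonzero: "x \<in> U \<Longrightarrow> det (g x) \<noteq> 0"
  by (rule pos_def_det_nonzero) (rule g_pos)

text \<open>The logarithmic derivative of the root of \<open>det g\<close> is the trace of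
  \<open>N\<close>: the Levi-Civita connection preserves the volume form.\<close>

lemma koszul1_trace:
  assumes "x \<in> U"
  shows "koszul1 \<Gamma> g x k = (\<Sum>i\<in>UNIV. N x i k i - \<Gamma> x i k i)"
proof -
  have "pderiv_at k (\<lambda>y. det (g y)) x = 2 * (\<Sum>i\<in>UNIV. N x i k i) * det (g x)"
    by (rule jacobi_formula_metric[OF g_diff g_sym metric]) (rule assms)+
  then show ?thesis
    using det_nonzero[OF assms] pderiv_at_sqrt_log[OF pderiv_at_det(1)[OF g_diff[OF assms]], of k]
    by (simp add: koszul1_eq sum_subtractf)
qed

lemma koszul1_alpha: "x \<in> U \<Longrightarrow> koszul1 D g x k = alpha x k"
  and koszul1_dual: "x \<in> U \<Longrightarrow> koszul1 dual g x k = - alpha x k"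
  by (simp_all add: koszul1_trace alpha_def dual_def sum_subtractf flip: sum_distrib_left)

lemma alpha_diff: "x \<in> U \<Longrightarrow> (\<lambda>y. alpha y k) differentiable (at x)"
  unfolding alpha_def by (intro differentiable_sum' differentiable_diff N_diff D_diff)

lemma h_diff: "x \<in> U \<Longrightarrow> (\<lambda>y. h y i j) differentiable (at x)"
  unfolding h_def by (rule matrix_inv_differentiable[OF open_U _ det_nonzero g_diff])

lemma sharp_diff: "x \<in> U \<Longrightarrow> (\<lambda>y. sharp y k) differentiable (at x)"
  unfolding sharp_def by (intro differentiable_sum' differentiable_mult alpha_diff h_diff)

lemma sqnorm_diff: "x \<in> U \<Longrightarrow> sqnorm differentiable (at x)"
  unfolding sqnorm_def by (intro differentiable_sum' differentiable_mult alpha_diff sharp_diff)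

lemma drift_diff: "x \<in> U \<Longrightarrow> (\<lambda>y. drift y k) differentiable (at x)"
  unfolding drift_def by (intro differentiable_minus differentiable_sum' differentiable_mult h_diff N_diff)

lemma h_cont: "continuous_on U (\<lambda>x. h x i j)"
  and drift_cont: "continuous_on U (\<lambda>x. drift x k)"
  by (rule differentiable_imp_continuous_on,
      simp add: differentiable_on_def differentiable_at_withinI h_diff drift_diff)+

lemma
  assumes x: "x \<in> U"
  shows g_h: "(\<Sum>l\<in>UNIV. g x $ i $ l * h x l j) = (if i = j then 1 else 0)"
    and h_g: "(\<Sum>l\<in>UNIV. h x i l * g x $ l $ j) = (if i = j then 1 else 0)"
    and h_sym: "h x i j = h x j i"
proof -
  note inv = matrix_inv_mult[OF det_nonzero[OF x]]
  have 1: "(A ** B) $ i $ j = (\<Sum>l\<in>UNIV. A $ i $ l * B $ l $ j)" for A B :: "real^'n^'n"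
    by (simp add: matrix_matrix_mult_def)
  show "(\<Sum>l\<in>UNIV. g x $ i $ l * h x l j) = (if i = j then 1 else 0)"
    "(\<Sum>l\<in>UNIV. h x i l * g x $ l $ j) = (if i = j then 1 else 0)"
    unfolding h_def 1[symmetric] inv by (simp_all add: mat_def)
  have "transpose (g x) = g x" using g_sym[OF x] by (simp add: transpose_def vec_eq_iff)
  then have "transpose (matrix_inv (g x)) ** g x = mat 1"
    using inv(1) by (metis matrix_transpose_mul transpose_mat)
  then have "transpose (matrix_inv (g x)) = matrix_inv (g x)"
    using inv(1) by (metis matrix_mul_assoc matrix_mul_lid matrix_mul_rid)
  then have "transpose (matrix_inv (g x)) $ i $ j = matrix_inv (g x) $ i $ j" by simp
  then show "h x i j = h x j i"
    by (simp add: h_def transpose_def)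
qed

lemma g_sharp:
  assumes x: "x \<in> U"
  shows "(\<Sum>l\<in>UNIV. g x $ i $ l * sharp x l) = alpha x i"
proof -
  have "(\<Sum>l\<in>UNIV. g x $ i $ l * sharp x l) = (\<Sum>l\<in>UNIV. \<Sum>j\<in>UNIV. g x $ i $ l * h x l j * alpha x j)"
    by (simp add: sharp_def sum_distrib_left mult.assoc)
  also have "\<dots> = (\<Sum>j\<in>UNIV. (\<Sum>l\<in>UNIV. g x $ i $ l * h x l j) * alpha x j)"
    by (subst sum.swap) (simp add: sum_distrib_right)
  finally show ?thesis by (simp add: g_h[OF x] if_distrib[of "\<lambda>u. u * c" for c] cong: if_cong)
qed

text \<open>Raising the index of \<open>v\<close> gives \<open>w\<close> with
  \<open>g x *v w = v\<close>, so the form of \<open>h\<close> at \<open>v\<close> is the form of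
  \<open>g\<close> at \<open>w\<close>.\<close>

lemma h_pos:
  assumes x: "x \<in> U" and v: "\<exists>i. v i \<noteq> 0"
  shows "0 < (\<Sum>i\<in>UNIV. \<Sum>j\<in>UNIV. h x i j * v i * v j)"
proof -
  define w where "w = (\<chi> i. \<Sum>j\<in>UNIV. h x i j * v j)"
  have gw: "g x *v w = (\<chi> i. v i)"
  proof -
    have "(g x *v w) $ i = (\<Sum>j\<in>UNIV. (\<Sum>l\<in>UNIV. g x $ i $ l * h x l j) * v j)" for i
      unfolding matrix_vector_mult_def w_def
      by (simp add: sum_distrib_left sum_distrib_right mult.assoc) (rule sum.swap)
    then show ?thesis
      by (simp add: vec_eq_iff g_h[OF x] if_distrib[of "\<lambda>u. u * c" for c] cong: if_cong)
  qed
  have "w \<noteq> 0"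
  proof
    assume "w = 0"
    then have "(\<chi> i. v i) = 0" using gw by simp
    then show False using v by (simp add: vec_eq_iff)
  qed
  then have "0 < w \<bullet> (\<chi> i. v i)" using g_pos[OF x] gw by metis
  also have "\<dots> = (\<Sum>i\<in>UNIV. \<Sum>j\<in>UNIV. h x i j * v i * v j)"
    by (simp add: inner_vec_def w_def sum_distrib_left sum_distrib_right mult_ac)
  finally show ?thesis .
qed

text \<open>\<open>S\<close> is \<gamma> with its index lowered. Symmetry in the first two indices
  is torsion freeness of both connections. The D-derivative of the metric is
  \<open>S k i j + S k j i\<close>, so the Codazzi equation adds the exchange of the first and last
  index, and the two exchanges generate all permutations.\<close>

lemma difference_tensor_sym:
  assumes x: "x \<in> U"
  defines "S \<equiv> \<lambda>k i j. \<Sum>l\<in>UNIV. (N x l k i - D x l k i) * g x $ l $ j"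
  shows "S k i j = S i k j" "S k i j = S k j i"
proof -
  show 1: "S k i j = S i k j" for k i j
    by (simp add: S_def N_sym[OF x, of _ k] D_sym[OF x, of _ k])
  have e: "(\<Sum>l\<in>UNIV. N x l k i * g x $ l $ j + N x l k j * g x $ i $ l) -
       (\<Sum>l\<in>UNIV. D x l k i * g x $ l $ j + D x l k j * g x $ i $ l) = S k i j + S k j i" for k i j
    by (simp add: S_def g_sym[OF x, of i] sum.distrib sum_subtractf left_diff_distrib)
  have "S k i j + S k j i = S i k j + S i j k" for k i j
    using codazzi[OF x, of k i j] unfolding metric[OF x] e .
  then have "S k j i = S i j k" for k i j using 1[of k i j] by (metis add_left_imp_eq)
  then show "S k i j = S k j i" using 1 by metis
qed

lemma trace_difference_tensor:
  assumes x: "x \<in> U"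
  shows "(\<Sum>i\<in>UNIV. \<Sum>j\<in>UNIV. h x i j * (\<Sum>k\<in>UNIV. (N x k i j - D x k i j) * alpha x k)) = sqnorm x"
proof -
  define S where "S = (\<lambda>k i j. \<Sum>l\<in>UNIV. (N x l k i - D x l k i) * g x $ l $ j)"
  have S_sym: "S k i j = S i k j" "S k i j = S k j i" for k i j
    unfolding S_def by (rule difference_tensor_sym[OF x])+
  \<comment> \<open>Contracting the last two indices raises one again and leaves the trace that
    defines \<open>alpha\<close>.\<close>
  have tr: "(\<Sum>i\<in>UNIV. \<Sum>j\<in>UNIV. h x i j * S m i j) = alpha x m" for m
  proof -
    have "(\<Sum>j\<in>UNIV. h x i j * S m i j) = (\<Sum>l\<in>UNIV. (N x l m i - D x l m i) * (\<Sum>j\<in>UNIV. g x $ l $ j * h x j i))" for i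
    proof -
      have "(\<Sum>j\<in>UNIV. h x i j * S m i j) = (\<Sum>j\<in>UNIV. \<Sum>l\<in>UNIV. (N x l m i - D x l m i) * (g x $ l $ j * h x j i))"
        by (simp add: S_def sum_distrib_left h_sym[OF x, of i] mult_ac)
      then show ?thesis by (subst (asm) sum.swap) (simp add: sum_distrib_left)
    qed
    then show ?thesis by (simp add: g_h[OF x] alpha_def if_distrib cong: if_cong)
  qed
  have "(\<Sum>k\<in>UNIV. (N x k i j - D x k i j) * alpha x k) = (\<Sum>m\<in>UNIV. S m i j * sharp x m)" for i j
  proof -
    have "(\<Sum>k\<in>UNIV. (N x k i j - D x k i j) * alpha x k)
        = (\<Sum>k\<in>UNIV. \<Sum>m\<in>UNIV. (N x k i j - D x k i j) * g x $ k $ m * sharp x m)"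
      by (simp add: sum_distrib_left mult.assoc flip: g_sharp[OF x])
    also have "\<dots> = (\<Sum>m\<in>UNIV. S i j m * sharp x m)"
      by (subst sum.swap) (simp add: S_def sum_distrib_right)
    \<comment> \<open>Total symmetry moves the index paired with \<open>sharp\<close> to the front,
      so that \<open>tr\<close> applies to the other two.\<close>
    also have "\<dots> = (\<Sum>m\<in>UNIV. S m i j * sharp x m)"
      by (intro sum.cong refl arg_cong2[where f = times] trans[OF S_sym(2) S_sym(1)])
    finally show ?thesis .
  qed
  then have "(\<Sum>i\<in>UNIV. \<Sum>j\<in>UNIV. h x i j * (\<Sum>k\<in>UNIV. (N x k i j - D x k i j) * alpha x k))
      = (\<Sum>i\<in>UNIV. \<Sum>j\<in>UNIV. \<Sum>m\<in>UNIV. h x i j * S m i j * sharp x m)"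
    by (simp add: sum_distrib_left mult.assoc)
  also have "\<dots> = (\<Sum>i\<in>UNIV. \<Sum>m\<in>UNIV. \<Sum>j\<in>UNIV. h x i j * S m i j * sharp x m)"
    by (intro sum.cong refl sum.swap)
  also have "\<dots> = (\<Sum>m\<in>UNIV. \<Sum>i\<in>UNIV. \<Sum>j\<in>UNIV. h x i j * S m i j * sharp x m)"
    by (rule sum.swap)
  also have "\<dots> = sqnorm x"
    by (simp add: sqnorm_def tr flip: sum_distrib_right)
  finally show ?thesis .
qed

end

section \<open>Charts with equal second Koszul forms\<close>

locale equal_koszul_chart = codazzi_chart U g N D
  for U :: "(real^'n::finite) set" and g N D +
  assumes equal_koszul: "\<And>x i j. x \<in> U \<Longrightarrow> koszul2 D g x i j = koszul2 dual g x i j"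
begin

lemma
  assumes x: "x \<in> U"
  shows alpha_parallel: "pderiv_at i (\<lambda>y. alpha y j) x = (\<Sum>k\<in>UNIV. N x k i j * alpha x k)"
    and koszul2_alpha: "koszul2 D g x i j = (\<Sum>k\<in>UNIV. (N x k i j - D x k i j) * alpha x k)"
proof -
  have 1: "koszul2 D g x i j = pderiv_at i (\<lambda>y. alpha y j) x - (\<Sum>k\<in>UNIV. D x k i j * alpha x k)"
    unfolding koszul2_def cov_deriv_form_def
    by (simp add: koszul1_alpha x pderiv_at_cong[OF open_U x, of "\<lambda>y. koszul1 D g y j" "\<lambda>y. alpha y j"])
  have "koszul2 dual g x i j = - pderiv_at i (\<lambda>y. alpha y j) x + (\<Sum>k\<in>UNIV. dual x k i j * alpha x k)"
    unfolding koszul2_def cov_deriv_form_def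
    by (simp add: koszul1_dual x pderiv_at_cong[OF open_U x, of "\<lambda>y. koszul1 dual g y j" "\<lambda>y. - alpha y j"]
        pderiv_at_minus alpha_diff sum_negf)
  also have "(\<Sum>k\<in>UNIV. dual x k i j * alpha x k) = 2 * (\<Sum>k\<in>UNIV. N x k i j * alpha x k) - (\<Sum>k\<in>UNIV. D x k i j * alpha x k)"
    by (simp add: dual_def left_diff_distrib sum_subtractf sum_distrib_left mult.assoc)
  finally show 2: "pderiv_at i (\<lambda>y. alpha y j) x = (\<Sum>k\<in>UNIV. N x k i j * alpha x k)"
    using 1 equal_koszul[OF x, of i j] by simp
  show "koszul2 D g x i j = (\<Sum>k\<in>UNIV. (N x k i j - D x k i j) * alpha x k)"
    unfolding 1 2 by (simp add: left_diff_distrib sum_subtractf)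
qed

text \<open>Differentiating \<open>g_sharp\<close> and using that \<open>g\<close> and
  \<open>alpha\<close> are parallel shows that \<open>g\<close> annihilates the covariant derivative
  \<open>W\<close> of \<open>sharp\<close>; this avoids differentiating the inverse metric.\<close>

lemma sharp_parallel:
  assumes x: "x \<in> U"
  shows "pderiv_at k (\<lambda>y. sharp y i) x = - (\<Sum>j\<in>UNIV. N x i k j * sharp x j)"
proof -
  define W where "W l = (\<Sum>j\<in>UNIV. N x l k j * sharp x j) + pderiv_at k (\<lambda>y. sharp y l) x" for l
  have gW: "(\<Sum>l\<in>UNIV. g x $ i $ l * W l) = 0" for i
  proof -
    have "(\<Sum>m\<in>UNIV. N x m k i * alpha x m) = pderiv_at k (\<lambda>y. alpha y i) x"
      by (simp add: alpha_parallel[OF x])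
    also have "\<dots> = pderiv_at k (\<lambda>y. \<Sum>j\<in>UNIV. g y $ i $ j * sharp y j) x"
      by (rule pderiv_at_cong[OF open_U x]) (simp add: g_sharp)
    also have "\<dots> = (\<Sum>j\<in>UNIV. g x $ i $ j * pderiv_at k (\<lambda>y. sharp y j) x) +
        (\<Sum>j\<in>UNIV. pderiv_at k (\<lambda>y. g y $ i $ j) x * sharp x j)"
      using g_diff[OF x] sharp_diff[OF x]
      by (subst pderiv_at_sum) (auto intro!: differentiable_mult simp: pderiv_at_mult sum.distrib)
    also have "(\<Sum>j\<in>UNIV. pderiv_at k (\<lambda>y. g y $ i $ j) x * sharp x j) =
        (\<Sum>j\<in>UNIV. \<Sum>l\<in>UNIV. N x l k i * g x $ l $ j * sharp x j) + (\<Sum>j\<in>UNIV. \<Sum>l\<in>UNIV. N x l k j * g x $ i $ l * sharp x j)"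
      by (simp add: metric[OF x] sum_distrib_right sum.distrib distrib_right)
    also have "(\<Sum>j\<in>UNIV. \<Sum>l\<in>UNIV. N x l k i * g x $ l $ j * sharp x j) = (\<Sum>l\<in>UNIV. N x l k i * (\<Sum>j\<in>UNIV. g x $ l $ j * sharp x j))"
      by (subst sum.swap) (simp add: sum_distrib_left mult.assoc)
    also have "\<dots> = (\<Sum>l\<in>UNIV. N x l k i * alpha x l)" by (simp add: g_sharp[OF x])
    also have "(\<Sum>j\<in>UNIV. \<Sum>l\<in>UNIV. N x l k j * g x $ i $ l * sharp x j) = (\<Sum>l\<in>UNIV. g x $ i $ l * (\<Sum>j\<in>UNIV. N x l k j * sharp x j))"
      by (subst sum.swap) (simp add: sum_distrib_left mult_ac)
    finally show ?thesis by (simp add: W_def distrib_left sum.distrib)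
  qed
  have "W i = (\<Sum>l\<in>UNIV. (\<Sum>j\<in>UNIV. h x i j * g x $ j $ l) * W l)"
    by (simp add: h_g[OF x] if_distrib[of "\<lambda>u. u * c" for c] cong: if_cong)
  also have "\<dots> = (\<Sum>j\<in>UNIV. h x i j * (\<Sum>l\<in>UNIV. g x $ j $ l * W l))"
    by (simp add: sum_distrib_left sum_distrib_right mult.assoc) (rule sum.swap)
  finally have "W i = 0" by (simp add: gW)
  then show ?thesis by (simp add: W_def)
qed

text \<open>The connection terms of \<open>alpha_parallel\<close> and \<open>sharp_parallel\<close>
  have opposite signs and cancel.\<close>

lemma sqnorm_deriv:
  assumes x: "x \<in> U"
  shows "pderiv_at k sqnorm x = 0"
proof -
  have "pderiv_at k sqnorm x = (\<Sum>i\<in>UNIV. alpha x i * pderiv_at k (\<lambda>y. sharp y i) x) + (\<Sum>i\<in>UNIV. pderiv_at k (\<lambda>y. alpha y i) x * sharp x i)"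
    unfolding sqnorm_def[abs_def] using alpha_diff[OF x] sharp_diff[OF x]
    by (subst pderiv_at_sum) (auto intro!: differentiable_mult simp: pderiv_at_mult sum.distrib)
  also have "(\<Sum>i\<in>UNIV. alpha x i * pderiv_at k (\<lambda>y. sharp y i) x) = - (\<Sum>i\<in>UNIV. \<Sum>j\<in>UNIV. N x i k j * alpha x i * sharp x j)"
    by (simp add: sharp_parallel[OF x] sum_negf sum_distrib_left mult_ac)
  also have "(\<Sum>i\<in>UNIV. \<Sum>j\<in>UNIV. N x i k j * alpha x i * sharp x j) = (\<Sum>j\<in>UNIV. pderiv_at k (\<lambda>y. alpha y j) x * sharp x j)"
    by (subst sum.swap) (simp add: alpha_parallel[OF x] sum_distrib_right)
  finally show ?thesis by simp
qed

lemma soliton_laplacian: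
  assumes x: "x \<in> U"
    and soliton: "\<And>i j. koszul2 D g x i j - hess N F x i j = lam * g x $ i $ j"
  shows "elliptic_op h drift F x = sqnorm x - lam * CARD('n)"
proof -
  have F: "pderiv_at i (pderiv_at j F) x =
      (\<Sum>k\<in>UNIV. (N x k i j - D x k i j) * alpha x k) - lam * g x $ i $ j + (\<Sum>k\<in>UNIV. N x k i j * pderiv_at k F x)" for i j
    using soliton[of i j] koszul2_alpha[OF x, of i j] by (simp add: hess_def cov_deriv_form_def)
  \<comment> \<open>\<open>elliptic_op\<close> and \<open>hess\<close> differentiate in opposite
    orders. Symmetry of \<open>h\<close> reconciles them without commuting derivatives of
    \<open>F\<close>.\<close>
  have "(\<Sum>i\<in>UNIV. \<Sum>j\<in>UNIV. h x i j * pderiv_at j (pderiv_at i F) x) = (\<Sum>j\<in>UNIV. \<Sum>i\<in>UNIV. h x j i * pderiv_at j (pderiv_at i F) x)"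
    by (subst sum.swap) (simp only: h_sym[OF x])
  also have "\<dots> = (\<Sum>i\<in>UNIV. \<Sum>j\<in>UNIV. h x i j * (\<Sum>k\<in>UNIV. (N x k i j - D x k i j) * alpha x k))
      - lam * (\<Sum>i\<in>UNIV. \<Sum>j\<in>UNIV. h x i j * g x $ j $ i)
      + (\<Sum>i\<in>UNIV. \<Sum>j\<in>UNIV. h x i j * (\<Sum>k\<in>UNIV. N x k i j * pderiv_at k F x))"
  proof -
    have "h x i j * pderiv_at i (pderiv_at j F) x = h x i j * (\<Sum>k\<in>UNIV. (N x k i j - D x k i j) * alpha x k)
        - lam * (h x i j * g x $ j $ i) + h x i j * (\<Sum>k\<in>UNIV. N x k i j * pderiv_at k F x)" for i j
      unfolding F by (simp add: algebra_simps g_sym[OF x, of i])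
    then show ?thesis by (simp add: sum.distrib sum_subtractf sum_distrib_left)
  qed
  also have "(\<Sum>i\<in>UNIV. \<Sum>j\<in>UNIV. h x i j * g x $ j $ i) = CARD('n)"
    by (simp add: h_g[OF x])
  also have "(\<Sum>i\<in>UNIV. \<Sum>j\<in>UNIV. h x i j * (\<Sum>k\<in>UNIV. N x k i j * pderiv_at k F x)) = - (\<Sum>k\<in>UNIV. drift x k * pderiv_at k F x)"
  proof -
    have "(\<Sum>i\<in>UNIV. \<Sum>j\<in>UNIV. h x i j * (\<Sum>k\<in>UNIV. N x k i j * pderiv_at k F x)) =
        (\<Sum>i\<in>UNIV. \<Sum>j\<in>UNIV. \<Sum>k\<in>UNIV. h x i j * N x k i j * pderiv_at k F x)"
      by (simp add: sum_distrib_left mult.assoc)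
    also have "\<dots> = (\<Sum>i\<in>UNIV. \<Sum>k\<in>UNIV. \<Sum>j\<in>UNIV. h x i j * N x k i j * pderiv_at k F x)"
      by (intro sum.cong refl sum.swap)
    also have "\<dots> = (\<Sum>k\<in>UNIV. \<Sum>i\<in>UNIV. \<Sum>j\<in>UNIV. h x i j * N x k i j * pderiv_at k F x)"
      by (rule sum.swap)
    finally show ?thesis by (simp add: drift_def sum_distrib_right sum_negf)
  qed
  finally show ?thesis
    by (simp add: elliptic_op_def trace_difference_tensor[OF x])
qed

end

text \<open>The hypotheses are the coordinate laws at a single point, with \<open>J\<close> the
  Jacobian matrix and \<gamma> transforming as a tensor. Traces are invariant under conjugation, so
  \<open>alpha\<close> transforms as a covector; hence \<open>sharp\<close> transforms as a vector,
  and their pairing is invariant.\<close>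

lemma sqnorm_invariant:
  fixes J :: "'n::finite \<Rightarrow> 'n \<Rightarrow> real"
  assumes c: "codazzi_chart U g N D" and c': "codazzi_chart U' g' N' D'"
    and x: "x \<in> U" and x': "x' \<in> U'"
    and g: "\<And>i j. g x $ i $ j = (\<Sum>a\<in>UNIV. \<Sum>b\<in>UNIV. J a i * J b j * g' x' $ a $ b)"
    and N: "\<And>m i j. (\<Sum>k\<in>UNIV. (N x k i j - D x k i j) * J m k) =
        (\<Sum>a\<in>UNIV. \<Sum>b\<in>UNIV. J a i * J b j * (N' x' m a b - D' x' m a b))"
  shows "codazzi_chart.sqnorm g N D x = codazzi_chart.sqnorm g' N' D' x'"
proof -
  interpret c: codazzi_chart U g N D by fact
  interpret c': codazzi_chart U' g' N' D' by fact
  define j where "j = (\<chi> m i. J m i)"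
  have G: "g x = transpose j ** g' x' ** j"
    by (simp add: vec_eq_iff g matrix_matrix_mult_def transpose_def j_def sum_distrib_left sum_distrib_right)
      (subst sum.swap, simp add: mult_ac)
  \<comment> \<open>Invertibility of the Jacobian comes from the law for the metric, without the
    inverse transition map.\<close>
  have "det j \<noteq> 0"
    using c.det_nonzero[OF x] by (auto simp: G det_mul)
  note inv = matrix_inv_mult[OF this]
  define P where "P i = (\<chi> k l. N x k i l - D x k i l)" for i
  define P' where "P' a = (\<chi> k l. N' x' k a l - D' x' k a l)" for a
  have alpha: "c.alpha x i = (\<Sum>a\<in>UNIV. J a i * c'.alpha x' a)" for i
  proof -
    \<comment> \<open>Conjugating \<open>P i\<close> by \<open>j\<close> yields this combination of
      the \<open>P' a\<close>, so the traces agree.\<close>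
    define R where "R = (\<chi> k l. \<Sum>a\<in>UNIV. J a i * P' a $ k $ l)"
    have "j ** P i = R ** j"
      using N by (simp add: vec_eq_iff matrix_matrix_mult_def j_def P_def P'_def R_def mult_ac sum_distrib_left sum_distrib_right)
        (subst sum.swap, simp add: mult_ac)
    then have "P i = matrix_inv j ** (R ** j)"
      by (metis inv(2) matrix_mul_assoc matrix_mul_lid)
    then have "trace (P i) = trace (R ** j ** matrix_inv j)"
      by (rule trans[OF arg_cong[where f = trace] trace_mul_sym])
    also have "\<dots> = trace R" by (simp add: inv(1) flip: matrix_mul_assoc)
    finally have "trace (P i) = trace R" .
    moreover have "trace R = (\<Sum>a\<in>UNIV. J a i * c'.alpha x' a)"
      unfolding trace_def R_def c'.alpha_def P'_def
      by (simp add: sum_distrib_left) (rule sum.swap)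
    ultimately show ?thesis by (simp add: trace_def P_def c.alpha_def)
  qed
  define s s' \<alpha> \<alpha>' where "s = (\<chi> i. c.sharp x i)" and "s' = (\<chi> i. c'.sharp x' i)"
    and "\<alpha> = (\<chi> i. c.alpha x i)" and "\<alpha>' = (\<chi> i. c'.alpha x' i)"
  have \<alpha>: "\<alpha> = transpose j *v \<alpha>'"
    by (simp add: vec_eq_iff \<alpha>_def \<alpha>'_def alpha matrix_vector_mult_def transpose_def j_def)
  have "g x *v s = \<alpha>" "g' x' *v s' = \<alpha>'"
    by (simp_all add: vec_eq_iff s_def s'_def \<alpha>_def \<alpha>'_def matrix_vector_mult_def c.g_sharp[OF x] c'.g_sharp[OF x'])
  then have "transpose j *v (g' x' *v (j *v s)) = transpose j *v (g' x' *v s')"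
    by (metis G \<alpha> matrix_vector_mul_assoc)
  moreover have "invertible (transpose j ** g' x')"
    using \<open>det j \<noteq> 0\<close> c'.det_nonzero[OF x'] by (simp add: invertible_det_nz det_mul)
  ultimately have js: "j *v s = s'"
    by (simp add: matrix_vector_mul_assoc) (metis invertible_def matrix_vector_mul_assoc matrix_vector_mul_lid)
  have "c.sqnorm x = \<alpha> \<bullet> s" "c'.sqnorm x' = \<alpha>' \<bullet> s'"
    by (simp_all add: c.sqnorm_def c'.sqnorm_def inner_vec_def s_def s'_def \<alpha>_def \<alpha>'_def)
  moreover have "\<alpha> \<bullet> s = \<alpha>' \<bullet> s'"
    unfolding \<alpha> js[symmetric] by (metis dot_lmul_matrix transpose_matrix_vector)
  ultimately show ?thesis by simp
qed

lemma elliptic_op_uminus: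
  assumes "open U" "x \<in> U" "\<And>y. y \<in> U \<Longrightarrow> u differentiable (at y)" "\<And>i. (\<lambda>y. pderiv_at i u y) differentiable (at x)"
  shows "(\<lambda>y. pderiv_at i (\<lambda>y. - u y) y) differentiable (at x)"
    and "elliptic_op a b (\<lambda>y. - u y) x = - elliptic_op a b u x"
proof -
  have z: "pderiv_at i (\<lambda>y. 0) = (\<lambda>y. 0)" for i by auto
  have "elliptic_op a b (\<lambda>y. 0) x = 0" by (simp add: elliptic_op_def z)
  then show "(\<lambda>y. pderiv_at i (\<lambda>y. - u y) y) differentiable (at x)"
    "elliptic_op a b (\<lambda>y. - u y) x = - elliptic_op a b u x"
    using elliptic_op_add_cmult[OF assms(1,2), where u = "\<lambda>_. 0" and w = u and c = "-1"] assms(3,4) by (simp_all add: z)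
qed

section \<open>Charts and the global argument\<close>

lemma
  assumes c: "is_chart M c"
  shows chart_inv_snd: "p \<in> fst c \<Longrightarrow> chart_inv c (snd c p) = p"
    and snd_chart_inv: "x \<in> chart_image c \<Longrightarrow> snd c (chart_inv c x) = x"
    and chart_inv_in: "x \<in> chart_image c \<Longrightarrow> chart_inv c x \<in> fst c"
    and chart_inv_homeomorphic: "homeomorphic_map (top_of_set (chart_image c)) (subtopology M (fst c)) (chart_inv c)"
proof -
  have sub: "fst c \<subseteq> topspace M" and hm: "homeomorphic_map (subtopology M (fst c)) (top_of_set (chart_image c)) (snd c)"
    using c openin_subset by (auto simp: is_chart_def)
  then have inj: "inj_on (snd c) (fst c)"
    using homeomorphic_imp_injective_map[OF hm] by (simp add: inf.absorb2)
  then show 1: "p \<in> fst c \<Longrightarrow> chart_inv c (snd c p) = p" for p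
    by (simp add: chart_inv_def)
  show 2: "x \<in> chart_image c \<Longrightarrow> snd c (chart_inv c x) = x" for x
    by (simp add: chart_inv_def chart_image_def f_inv_into_f)
  show "x \<in> chart_image c \<Longrightarrow> chart_inv c x \<in> fst c"
    by (simp add: chart_inv_def chart_image_def inv_into_into)
  obtain k where "homeomorphic_maps (subtopology M (fst c)) (top_of_set (chart_image c)) (snd c) k"
    using hm homeomorphic_map_maps by blast
  then have k: "homeomorphic_map (top_of_set (chart_image c)) (subtopology M (fst c)) k" "\<And>p. p \<in> fst c \<Longrightarrow> k (snd c p) = p"
    using sub by (auto simp: homeomorphic_maps_map inf.absorb2)
  show "homeomorphic_map (top_of_set (chart_image c)) (subtopology M (fst c)) (chart_inv c)"
    by (rule homeomorphic_map_eq[OF k(1)]) (use 1 k(2) in \<open>auto simp: chart_image_def\<close>)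
qed

lemma
  assumes c: "is_chart M c" and S: "S \<subseteq> chart_image c"
  shows openin_chart_inv_image: "open S \<Longrightarrow> openin M (chart_inv c ` S)"
    and connectedin_chart_inv_image: "connected S \<Longrightarrow> connectedin M (chart_inv c ` S)"
proof -
  note hm = chart_inv_homeomorphic[OF c]
  show "openin M (chart_inv c ` S)" if "open S"
  proof -
    have "openin (top_of_set (chart_image c)) S" using that S by (simp add: open_subset)
    then have "openin (subtopology M (fst c)) (chart_inv c ` S)"
      using homeomorphic_imp_open_map[OF hm] by (simp add: open_map_def)
    then show ?thesis using c by (simp add: is_chart_def openin_open_subtopology)
  qed
  show "connectedin M (chart_inv c ` S)" if "connected S"
  proof -
    have "connectedin (top_of_set (chart_image c)) S" using that S by (simp add: connectedin_subtopology)
    then have "connectedin (subtopology M (fst c)) (chart_inv c ` S)"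
      using connectedin_continuous_map_image homeomorphic_imp_continuous_map[OF hm] by blast
    then show ?thesis by (simp add: connectedin_subtopology)
  qed
qed

lemma is_chart_ball:
  assumes c: "is_chart M c" and W: "openin M W" "p \<in> W" "p \<in> fst c"
  obtains e where "e > 0" "ball (snd c p) e \<subseteq> chart_image c" "chart_inv c ` ball (snd c p) e \<subseteq> W"
proof -
  have hm: "homeomorphic_map (subtopology M (fst c)) (top_of_set (chart_image c)) (snd c)"
    and op: "open (chart_image c)"
    using c by (auto simp: is_chart_def)
  have "openin (subtopology M (fst c)) (W \<inter> fst c)" using W(1) by (auto simp: openin_subtopology)
  then have "openin (top_of_set (chart_image c)) (snd c ` (W \<inter> fst c))"
    using homeomorphic_imp_open_map[OF hm] by (simp add: open_map_def)
  then have "open (snd c ` (W \<inter> fst c))" using op openin_open_eq by blast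
  then obtain e where e: "e > 0" "ball (snd c p) e \<subseteq> snd c ` (W \<inter> fst c)"
    using W open_contains_ball by blast
  show thesis
  proof (rule that[OF e(1)])
    show "ball (snd c p) e \<subseteq> chart_image c" using e(2) by (auto simp: chart_image_def)
    show "chart_inv c ` ball (snd c p) e \<subseteq> W"
      using e(2) chart_inv_snd[OF c] by (auto simp: subset_iff image_iff)
  qed
qed

section \<open>The soliton and its charts\<close>

locale equal_koszul_soliton =
  fixes M :: "'m topology" and A :: "('m, 'n::finite) chart set"
    and D nabla :: "('m, 'n) chart \<Rightarrow> 'n local_conn" and g :: "('m, 'n) chart \<Rightarrow> 'n local_metric"
    and f :: "'m \<Rightarrow> real" and lam :: real
  assumes compact: "compact_space M"
    and soliton: "gradient_hesse_soliton M A D g nabla f lam"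
    and koszul: "\<forall>c\<in>A. \<forall>x\<in>chart_image c. \<forall>i j.
           koszul2 (D c) (g c) x i j = koszul2 (dual_conn nabla D c) (g c) x i j"
begin

lemma
  shows hessian: "hessian_manifold M A D g" and levi_civita: "levi_civita A g nabla" and smooth_f: "smooth_function A f"
    and soliton_eq: "c \<in> A \<Longrightarrow> x \<in> chart_image c \<Longrightarrow>
        koszul2 (D c) (g c) x i j - cov_deriv_form (nabla c) (\<lambda>y k. pderiv_at k (f \<circ> chart_inv c) y) x i j = lam * g c x $ i $ j"
  using soliton unfolding gradient_hesse_soliton_def hess_def by blast+

lemma
  shows manifold: "smooth_manifold M A" and flat_D: "flat_connection A D" and riemannian: "riemannian_metric A g"
    and local_potential: "c \<in> A \<Longrightarrow> x \<in> chart_image c \<Longrightarrow> \<exists>V h. open V \<and> x \<in> V \<and> V \<subseteq> chart_image c \<and> smooth_on V h \<and>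
        (\<forall>y\<in>V. \<forall>i j. g c y $ i $ j = hess (D c) h y i j)"
  using hessian unfolding hessian_manifold_def by blast+

lemma chart: "c \<in> A \<Longrightarrow> is_chart M c"
  and covered: "p \<in> topspace M \<Longrightarrow> \<exists>c\<in>A. p \<in> fst c"
  using manifold by (auto simp: smooth_manifold_def)

lemma chart_sub: "c \<in> A \<Longrightarrow> p \<in> fst c \<Longrightarrow> p \<in> topspace M"
  using chart[of c] openin_subset[of M "fst c"] by (auto simp: is_chart_def)

lemma equal_koszul_chart:
  assumes c: "c \<in> A"
  shows "equal_koszul_chart (chart_image c) (g c) (nabla c) (D c)"
proof -
  have cD: "connection A D" and cN: "connection A nabla"
    using flat_D levi_civita by (auto simp: flat_connection_def levi_civita_def)
  have Dd: "\<And>x k i j. x \<in> chart_image c \<Longrightarrow> (\<lambda>y. D c y k i j) differentiable (at x)"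
    and Nd: "\<And>x k i j. x \<in> chart_image c \<Longrightarrow> (\<lambda>y. nabla c y k i j) differentiable (at x)"
    using cD cN c by (auto simp: connection_def intro!: smooth_on_imp_differentiable)
  have Ds: "\<And>x k i j. x \<in> chart_image c \<Longrightarrow> D c x k i j = D c x k j i"
    using flat_D c by (simp add: flat_connection_def torsion_def)
  interpret codazzi_chart "chart_image c" "g c" "nabla c" "D c"
  proof
    show "open (chart_image c)" using chart[OF c] by (simp add: is_chart_def)
    fix x assume x: "x \<in> chart_image c"
    show "(\<lambda>y. g c y $ i $ j) differentiable (at x)" for i j
      using riemannian c x smooth_on_imp_differentiable unfolding riemannian_metric_def by blast
    show "(\<lambda>y. nabla c y k i j) differentiable (at x)" "(\<lambda>y. D c y k i j) differentiable (at x)" for k i j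
      using Nd Dd x by auto
    show "g c x $ i $ j = g c x $ j $ i" for i j
      using riemannian c x by (simp add: riemannian_metric_def)
    show "v \<bullet> (g c x *v v) > 0" if "v \<noteq> 0" for v
      using riemannian c x that by (simp add: riemannian_metric_def)
    show "nabla c x k i j = nabla c x k j i" for k i j
      using levi_civita c x by (simp add: levi_civita_def torsion_def)
    show "D c x k i j = D c x k j i" for k i j using Ds x by simp
    show "pderiv_at k (\<lambda>y. g c y $ i $ j) x =
        (\<Sum>l\<in>UNIV. nabla c x l k i * g c x $ l $ j + nabla c x l k j * g c x $ i $ l)" for k i j
      using levi_civita c x by (simp add: levi_civita_def)
    \<comment> \<open>Potentials exist only near each point, which is enough for the pointwise
      Codazzi equation.\<close>
    obtain V u where V: "open V" "x \<in> V" "smooth_on V u"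
        "\<forall>y\<in>V. \<forall>i j. g c y $ i $ j = hess (D c) u y i j"
      using local_potential[OF c x] by blast
    have cu: "curvature (D c) x l i j k = 0" for l i j k
      using flat_D c x by (simp add: flat_connection_def)
    show "pderiv_at k (\<lambda>y. g c y $ i $ j) x - (\<Sum>l\<in>UNIV. D c x l k i * g c x $ l $ j + D c x l k j * g c x $ i $ l) =
        pderiv_at i (\<lambda>y. g c y $ k $ j) x - (\<Sum>l\<in>UNIV. D c x l i k * g c x $ l $ j + D c x l i j * g c x $ k $ l)" for k i j
      by (rule hessian_metric_codazzi[OF V(1-3) _ Dd[OF x] Ds[OF x] cu]) (use V(4) in blast)
  qed
  have "dual_conn nabla D c = dual" by (intro ext) (simp add: dual_conn_def dual_def)
  then show ?thesis
    by unfold_locales (use koszul c in simp)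
qed

lemma codazzi_chart: "c \<in> A \<Longrightarrow> codazzi_chart (chart_image c) (g c) (nabla c) (D c)"
  using equal_koszul_chart by (simp add: equal_koszul_chart_def)

abbreviation sq :: "('m, 'n) chart \<Rightarrow> real^'n \<Rightarrow> real" where
  "sq c \<equiv> codazzi_chart.sqnorm (g c) (nabla c) (D c)"

abbreviation lap :: "('m, 'n) chart \<Rightarrow> (real^'n \<Rightarrow> real) \<Rightarrow> real^'n \<Rightarrow> real" where
  "lap c \<equiv> elliptic_op (codazzi_chart.h (g c)) (codazzi_chart.drift (g c) (nabla c))"

lemma lap_soliton:
  assumes "c \<in> A" "x \<in> chart_image c"
  shows "lap c (f \<circ> chart_inv c) x = sq c x - lam * CARD('n)"
  using equal_koszul_chart.soliton_laplacian[OF equal_koszul_chart[OF assms(1)] assms(2)] soliton_eq[OF assms]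
  by (simp add: hess_def)

lemma f_diff:
  assumes "c \<in> A" "x \<in> chart_image c"
  shows "(f \<circ> chart_inv c) differentiable (at x)"
    and "(\<lambda>y. pderiv_at i (f \<circ> chart_inv c) y) differentiable (at x)"
  using smooth_f assms smooth_on_imp_differentiable smooth_on_pderiv_at unfolding smooth_function_def by metis+

text \<open>The inhomogeneous term in the law for connections is the same for \<open>nabla\<close>
  and \<open>D\<close>, so it drops out of their difference.\<close>

lemma sq_chart_independent:
  assumes c: "c \<in> A" "p \<in> fst c" and c': "c' \<in> A" "p \<in> fst c'"
  shows "sq c (snd c p) = sq c' (snd c' p)"
proof -
  let ?x = "snd c p" and ?J = "jac c c' (snd c p)"
  have ov: "?x \<in> overlap c c'" using assms by (auto simp: overlap_def)
  have t: "transition c c' ?x = snd c' p"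
    using chart_inv_snd[OF chart] c by (simp add: transition_def)
  have cD: "connection A D" and cN: "connection A nabla"
    using flat_D levi_civita by (auto simp: flat_connection_def levi_civita_def)
  have law: "(\<Sum>k\<in>UNIV. E c ?x k i j * ?J m k) =
          pderiv_at i (\<lambda>y. jac c c' y m j) ?x +
          (\<Sum>a\<in>UNIV. \<Sum>b\<in>UNIV. ?J a i * ?J b j * E c' (snd c' p) m a b)" if "connection A E" for E m i j
    using that c c' ov unfolding connection_def t[symmetric] by blast
  show ?thesis
  proof (rule sqnorm_invariant[OF codazzi_chart[OF c(1)] codazzi_chart[OF c'(1)]])
    show "?x \<in> chart_image c" "snd c' p \<in> chart_image c'" using c c' by (auto simp: chart_image_def)
    show "g c ?x $ i $ j = (\<Sum>a\<in>UNIV. \<Sum>b\<in>UNIV. ?J a i * ?J b j * g c' (snd c' p) $ a $ b)" for i j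
      using riemannian c c' ov unfolding riemannian_metric_def t[symmetric] by blast
    show "(\<Sum>k\<in>UNIV. (nabla c ?x k i j - D c ?x k i j) * ?J m k) =
        (\<Sum>a\<in>UNIV. \<Sum>b\<in>UNIV. ?J a i * ?J b j * (nabla c' (snd c' p) m a b - D c' (snd c' p) m a b))" for m i j
      using law[OF cN, of i j m] law[OF cD, of i j m]
      by (simp add: left_diff_distrib right_diff_distrib sum_subtractf)
  qed
qed

text \<open>The function |\<alpha>|^2 on \<open>M\<close>; by \<open>sq_chart_independent\<close>
  the chosen chart does not influence the value.\<close>

definition Q :: "'m \<Rightarrow> real" where
  "Q p = (let c = SOME c. c \<in> A \<and> p \<in> fst c in sq c (snd c p))"

lemma Q_eq:
  assumes "c \<in> A" "p \<in> fst c"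
  shows "Q p = sq c (snd c p)"
proof -
  have "\<exists>c. c \<in> A \<and> p \<in> fst c" using assms by blast
  from someI_ex[OF this] sq_chart_independent[OF _ _ assms] show ?thesis
    by (simp add: Q_def Let_def)
qed

lemma Q_locally_constant:
  assumes "p \<in> topspace M"
  obtains W where "openin M W" "p \<in> W" "\<And>q. q \<in> W \<Longrightarrow> Q q = Q p"
proof -
  obtain c where c: "c \<in> A" "p \<in> fst c" using covered[OF assms] by blast
  interpret equal_koszul_chart "chart_image c" "g c" "nabla c" "D c" by (rule equal_koszul_chart[OF c(1)])
  note ch = chart[OF c(1)]
  obtain e where e: "e > 0" "ball (snd c p) e \<subseteq> chart_image c"
    using is_chart_ball[OF ch openin_topspace assms c(2)] by metis
  have const: "sq c y = sq c (snd c p)" if "y \<in> ball (snd c p) e" for y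
    by (rule constant_on_ball_if_pderiv_zero[OF _ _ that]) (use e sqnorm_diff sqnorm_deriv in auto)
  show thesis
  proof (rule that)
    show "openin M (chart_inv c ` ball (snd c p) e)" by (rule openin_chart_inv_image[OF ch e(2)]) simp
    show "p \<in> chart_inv c ` ball (snd c p) e"
      using e(1) chart_inv_snd[OF ch c(2)] by (metis centre_in_ball imageI)
    fix q assume "q \<in> chart_inv c ` ball (snd c p) e"
    then obtain y where y: "y \<in> ball (snd c p) e" "q = chart_inv c y" by auto
    then have "q \<in> fst c" "snd c q = y"
      using chart_inv_in[OF ch] snd_chart_inv[OF ch] e(2) by auto
    then show "Q q = Q p" using Q_eq c const[OF y(1)] by metis
  qed
qed

text \<open>Local constancy makes the set open for every property \<open>P\<close>; applied to the
  negation of \<open>P\<close>, this also makes it closed.\<close>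

lemma
  shows Q_open: "openin M {p \<in> topspace M. P (Q p)}" and Q_closed: "closedin M {p \<in> topspace M. P (Q p)}"
proof -
  show *: "openin M {p \<in> topspace M. P (Q p)}" for P
  proof (subst openin_subopen, safe)
    fix p assume p: "p \<in> topspace M" "P (Q p)"
    obtain W where W: "openin M W" "p \<in> W" "\<And>q. q \<in> W \<Longrightarrow> Q q = Q p"
      using Q_locally_constant[OF p(1)] by blast
    have "W \<subseteq> {p \<in> topspace M. P (Q p)}"
    proof
      fix q assume q: "q \<in> W"
      have "P (Q q)" unfolding W(3)[OF q] by (rule p(2))
      then show "q \<in> {p \<in> topspace M. P (Q p)}" using q openin_subset[OF W(1)] by blast
    qed
    with W show "\<exists>T. openin M T \<and> p \<in> T \<and> T \<subseteq> {p \<in> topspace M. P (Q p)}" by blast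
  qed
  have "topspace M - {p \<in> topspace M. P (Q p)} = {p \<in> topspace M. \<not> P (Q p)}" by auto
  then show "closedin M {p \<in> topspace M. P (Q p)}"
    using *[of "\<lambda>q. \<not> P q"] by (auto simp: closedin_def)
qed

section \<open>Extrema of \<open>f\<close> and vanishing of its Laplacian\<close>

lemma f_continuous: "continuous_map M euclideanreal f"
proof -
  have "openin M {p \<in> topspace M. f p \<in> V}" if V: "open V" for V
  proof (subst openin_subopen, safe)
    fix p assume p: "p \<in> topspace M" "f p \<in> V"
    obtain c where c: "c \<in> A" "p \<in> fst c" using covered[OF p(1)] by blast
    note ch = chart[OF c(1)]
    let ?S = "chart_image c \<inter> (f \<circ> chart_inv c) -` V"
    have "continuous_on (chart_image c) (f \<circ> chart_inv c)"
      using smooth_f c(1) smooth_on_imp_continuous_on unfolding smooth_function_def by blast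
    then have "open ?S"
      by (rule continuous_open_preimage[OF _ _ V]) (use ch in \<open>simp add: is_chart_def\<close>)
    then have "openin M (chart_inv c ` ?S)" by (intro openin_chart_inv_image[OF ch]) auto
    moreover have "p \<in> chart_inv c ` ?S"
      using p c chart_inv_snd[OF ch] by (intro image_eqI[of _ _ "snd c p"]) (auto simp: chart_image_def)
    moreover have "chart_inv c ` ?S \<subseteq> {p \<in> topspace M. f p \<in> V}"
      using chart_inv_in[OF ch] chart_sub[OF c(1)] by auto
    ultimately show "\<exists>T. openin M T \<and> p \<in> T \<and> T \<subseteq> {p \<in> topspace M. f p \<in> V}" by blast
  qed
  then show ?thesis by (simp add: continuous_map_def)
qed

text \<open>Compactness of \<open>M\<close> enters the argument through this lemma alone.\<close>

lemma attains_max: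
  assumes "closedin M S" "S \<noteq> {}" "continuous_map M euclideanreal u"
  obtains p where "p \<in> S" "\<And>q. q \<in> S \<Longrightarrow> u q \<le> u p"
proof -
  have "compactin M S" using closedin_compact_space[OF compact assms(1)] .
  then have "compact (u ` S)" using image_compactin[OF _ assms(3)] by simp
  then show thesis using compact_attains_sup[of "u ` S"] assms(2) that by auto
qed

text \<open>The sign \<open>s\<close> treats local maxima (\<open>s = 1\<close>) and local minima
  (\<open>s = -1\<close>) of \<open>f\<close> together.\<close>

lemma local_max_lap:
  assumes c: "c \<in> A" "p \<in> fst c" and W: "openin M W" "p \<in> W"
    and s: "s = 1 \<or> s = -1" and max: "\<And>q. q \<in> W \<Longrightarrow> s * f q \<le> s * f p"
  shows "s * lap c (f \<circ> chart_inv c) (snd c p) \<le> 0"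
proof -
  interpret equal_koszul_chart "chart_image c" "g c" "nabla c" "D c" by (rule equal_koszul_chart[OF c(1)])
  note ch = chart[OF c(1)]
  define F where "F = f \<circ> chart_inv c"
  let ?x = "snd c p"
  obtain e where e: "e > 0" "ball ?x e \<subseteq> chart_image c" "chart_inv c ` ball ?x e \<subseteq> W"
    using is_chart_ball[OF ch W c(2)] by metis
  have x: "?x \<in> chart_image c" using c by (auto simp: chart_image_def)
  define u where "u = (\<lambda>y. s * F y)"
  have Fd: "\<And>y. y \<in> ball ?x e \<Longrightarrow> F differentiable (at y)" "\<And>i. (\<lambda>y. pderiv_at i F y) differentiable (at ?x)"
    using f_diff[OF c(1), folded F_def] e(2) x by blast+
  have u: "(\<lambda>y. pderiv_at i u y) differentiable (at ?x)" "lap c u ?x = s * lap c F ?x" for i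
    using s elliptic_op_uminus[of "ball ?x e" ?x F, OF _ _ Fd] e(1) Fd(2) by (auto simp: u_def)
  have "lap c u ?x \<le> 0"
  proof (rule elliptic_op_local_max[where a = h and x = ?x and r = e and u = u])
    show "h ?x i j = h ?x j i" for i j by (rule h_sym[OF x])
    show "e > 0" by (rule e(1))
    show "0 < (\<Sum>i\<in>UNIV. \<Sum>j\<in>UNIV. h ?x i j * v i * v j)" if "\<exists>i. v i \<noteq> 0" for v
      using h_pos[OF x that] .
    show "u y \<le> u ?x" if "y \<in> ball ?x e" for y
      using max[of "chart_inv c y"] e(3) that chart_inv_snd[OF ch c(2)] by (auto simp: u_def F_def image_subset_iff)
    show "u differentiable (at y)" if "y \<in> ball ?x e" for y
      unfolding u_def using Fd(1)[OF that] by (intro differentiable_mult) auto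
    show "(\<lambda>y. pderiv_at i u y) differentiable (at ?x)" for i by (rule u)
  qed
  then show ?thesis by (simp add: u(2) flip: F_def)
qed

text \<open>The set \<open>S\<close> of points violating the bound is clopen because \<open>Q\<close> is locally constant, so the
  maximum of \<open>s * f\<close> over \<open>S\<close> is a local maximum on \<open>M\<close>.\<close>

lemma Q_bound:
  assumes s: "s = 1 \<or> s = -1" and p: "p \<in> topspace M"
  shows "s * (Q p - lam * CARD('n)) \<le> 0"
proof (rule ccontr)
  assume neg: "\<not> ?thesis"
  define S where "S = {p \<in> topspace M. s * (Q p - lam * CARD('n)) > 0}"
  have S: "openin M S" "closedin M S" unfolding S_def by (rule Q_open, rule Q_closed)
  have "continuous_map M euclideanreal (\<lambda>p. s * f p)" by (intro continuous_intros f_continuous)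
  moreover have "S \<noteq> {}" using neg p by (auto simp: S_def)
  ultimately obtain q where q: "q \<in> S" "\<And>r. r \<in> S \<Longrightarrow> s * f r \<le> s * f q"
    using attains_max[OF S(2)] by blast
  then obtain c where c: "c \<in> A" "q \<in> fst c" using covered[of q] by (auto simp: S_def simp del: split_paired_Ex split_paired_All)
  have "s * lap c (f \<circ> chart_inv c) (snd c q) \<le> 0"
    by (rule local_max_lap[OF c S(1) q(1) s q(2)])
  moreover have "lap c (f \<circ> chart_inv c) (snd c q) = Q q - lam * CARD('n)"
    using lap_soliton[OF c(1)] Q_eq[OF c] c by (auto simp: chart_image_def)
  ultimately show False using q(1) by (simp add: S_def)
qed

lemma lap_zero:
  assumes c: "c \<in> A" "x \<in> chart_image c"
  shows "lap c (f \<circ> chart_inv c) x = 0"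
proof -
  note ch = chart[OF c(1)]
  let ?p = "chart_inv c x"
  have p: "?p \<in> fst c" "snd c ?p = x" using chart_inv_in[OF ch] snd_chart_inv[OF ch] c by auto
  \<comment> \<open>The two signs give opposite inequalities.\<close>
  then have "Q ?p = lam * CARD('n)"
    using Q_bound[of 1 ?p] Q_bound[of "-1" ?p] chart_sub[OF c(1)] by simp
  then show ?thesis using lap_soliton[OF c] Q_eq[OF c(1) p(1)] p(2) by simp
qed

section \<open>Constancy of \<open>f\<close> on components\<close>

lemma component_ball:
  assumes c: "c \<in> A" "q \<in> fst c" and q: "connected_component_of M p q"
  obtains e where "e > 0" "ball (snd c q) e \<subseteq> chart_image c"
    "chart_inv c ` ball (snd c q) e \<subseteq> connected_component_of_set M p"
proof -
  note ch = chart[OF c(1)]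
  obtain e where e: "e > 0" "ball (snd c q) e \<subseteq> chart_image c"
    using is_chart_ball[OF ch openin_topspace chart_sub[OF c] c(2)] by metis
  \<comment> \<open>Balls are connected, so the image of one stays in a single component; this is
    why components are open.\<close>
  have "connectedin M (chart_inv c ` ball (snd c q) e)"
    by (rule connectedin_chart_inv_image[OF ch e(2)]) simp
  moreover have "q \<in> chart_inv c ` ball (snd c q) e"
    using e(1) chart_inv_snd[OF ch c(2)] by (metis centre_in_ball imageI)
  ultimately have "chart_inv c ` ball (snd c q) e \<subseteq> connected_component_of_set M q"
    by (rule connected_component_of_maximal)
  also have "connected_component_of_set M q = connected_component_of_set M p"
    using q connected_component_of_equiv by metis
  finally show thesis using that e by blast
qed

text \<open>The set \<open>T\<close> where \<open>f\<close> attains its maximum over a component is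
  open by the strong maximum principle and closed by continuity, hence the entire component.\<close>

lemma f_constant_on_components:
  assumes p: "p \<in> topspace M"
  obtains m where "\<And>q. connected_component_of M p q \<Longrightarrow> f q = m"
proof -
  define K where "K = connected_component_of_set M p"
  have K: "closedin M K" "connectedin M K" "p \<in> K" "K \<subseteq> topspace M"
    using p by (auto simp: K_def closedin_connected_component_of connectedin_connected_component_of
        connected_component_of_refl connected_component_of_subset_topspace)
  then obtain r where r: "r \<in> K" "\<And>q. q \<in> K \<Longrightarrow> f q \<le> f r"
    using attains_max[OF K(1) _ f_continuous] by blast
  define T where "T = {q \<in> K. f q = f r}"
  have "openin M T"
  proof (subst openin_subopen, safe)
    fix q assume q: "q \<in> T"
    then have qK: "q \<in> K" "f q = f r" by (auto simp: T_def)
    obtain c where c: "c \<in> A" "q \<in> fst c" using covered qK K by blast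
    interpret equal_koszul_chart "chart_image c" "g c" "nabla c" "D c" by (rule equal_koszul_chart[OF c(1)])
    note ch = chart[OF c(1)]
    let ?F = "f \<circ> chart_inv c" and ?x = "snd c q"
    obtain e where e: "e > 0" "ball ?x e \<subseteq> chart_image c" "chart_inv c ` ball ?x e \<subseteq> K"
      using component_ball[OF c, of p] qK unfolding K_def by blast
    have Fx: "?F ?x = f r" using chart_inv_snd[OF ch c(2)] qK by simp
    have "\<exists>e'>0. \<forall>y\<in>ball ?x e'. ?F y = ?F ?x"
    proof (rule strong_maximum_principle[of "ball ?x e"])
      show "?x \<in> ball ?x e" using e by simp
      show "continuous_on (ball ?x e) (\<lambda>x. h x i j)" "continuous_on (ball ?x e) (\<lambda>x. drift x k)" for i j k
        using h_cont drift_cont e(2) continuous_on_subset by blast+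
      fix y assume y: "y \<in> ball ?x e"
      then have yU: "y \<in> chart_image c" using e by blast
      show "?F differentiable (at y)" "(\<lambda>y. pderiv_at i ?F y) differentiable (at y)" for i
        by (rule f_diff[OF c(1) yU])+
      show "h y i j = h y j i" for i j by (rule h_sym[OF yU])
      show "0 < (\<Sum>i\<in>UNIV. \<Sum>j\<in>UNIV. h y i j * v i * v j)" if "\<exists>i. v i \<noteq> 0" for v
        by (rule h_pos[OF yU that])
      show "elliptic_op h drift ?F y \<ge> 0" using lap_zero[OF c(1) yU] by simp
      show "?F y \<le> ?F ?x" unfolding Fx using r(2)[of "chart_inv c y"] e(3) y by (auto simp: image_subset_iff)
    qed simp
    then obtain e' where e': "e' > 0" "\<And>y. y \<in> ball ?x e' \<Longrightarrow> ?F y = f r" unfolding Fx by blast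
    \<comment> \<open>\<open>e\<close> keeps the image inside the component, and \<open>e'\<close>
      inside the region where \<open>f\<close> takes its maximum.\<close>
    let ?B = "ball ?x (min e e')"
    have "openin M (chart_inv c ` ?B)" by (rule openin_chart_inv_image[OF ch]) (use e(2) in auto)
    moreover have "q \<in> chart_inv c ` ?B"
      using e(1) e'(1) chart_inv_snd[OF ch c(2)] by (intro image_eqI[of _ _ ?x]) auto
    moreover have "chart_inv c ` ?B \<subseteq> T"
      using e(3) e'(2) by (auto simp: T_def)
    ultimately show "\<exists>W. openin M W \<and> q \<in> W \<and> W \<subseteq> T" by blast
  qed
  moreover have "closedin M T"
  proof -
    have "closedin M {q \<in> topspace M. f q \<in> {f r}}"
      by (rule closedin_continuous_map_preimage[OF f_continuous]) simp
    then have "closedin M (K \<inter> {q \<in> topspace M. f q \<in> {f r}})" using K by blast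
    moreover have "K \<inter> {q \<in> topspace M. f q \<in> {f r}} = T" using K by (auto simp: T_def)
    ultimately show ?thesis by simp
  qed
  moreover have "T = T \<inter> K" by (auto simp: T_def)
  ultimately have "openin (subtopology M K) T" "closedin (subtopology M K) T"
    unfolding openin_subtopology closedin_subtopology by blast+
  then have "T = K"
    using K(2) r(1) by (auto simp: connectedin_def connected_space_clopen_in T_def inf.absorb2)
  then show thesis using that[of "f r"] by (auto simp: T_def K_def)
qed

text \<open>Near each point \<open>f\<close> is constant, so its Hessian drops out of the soliton
  equation.\<close>

lemma koszul2_eq:
  assumes c: "c \<in> A" "x \<in> chart_image c"
  shows "koszul2 (D c) (g c) x i j = lam * g c x $ i $ j"
proof -
  note ch = chart[OF c(1)]
  let ?p = "chart_inv c x" and ?F = "f \<circ> chart_inv c"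
  have p: "?p \<in> fst c" "snd c ?p = x" using chart_inv_in[OF ch] snd_chart_inv[OF ch] c by auto
  have pM: "?p \<in> topspace M" by (rule chart_sub[OF c(1) p(1)])
  obtain m where m: "\<And>q. connected_component_of M ?p q \<Longrightarrow> f q = m"
    using f_constant_on_components[OF pM] by blast
  obtain e where e: "e > 0" "chart_inv c ` ball x e \<subseteq> connected_component_of_set M ?p"
    using component_ball[OF c(1) p(1)] pM connected_component_of_refl p(2) by metis
  have F: "?F y = m" if "y \<in> ball x e" for y using m[of "chart_inv c y"] e(2) that by (auto simp: image_subset_iff)
  \<comment> \<open>Needed on a whole ball and not only at \<open>x\<close>, since these derivatives
    are differentiated again.\<close>
  have 1: "pderiv_at k ?F y = 0" if "y \<in> ball x e" for k y
    using pderiv_at_cong[OF open_ball that, of ?F "\<lambda>_. m"] F by simp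
  have 2: "pderiv_at k (\<lambda>y. pderiv_at l ?F y) x = 0" for k l
    using pderiv_at_cong[OF open_ball, of x x e "\<lambda>y. pderiv_at l ?F y" "\<lambda>_. 0"] 1 e(1) by simp
  show ?thesis using soliton_eq[OF c, of i j] 1[of x] 2 e(1) by (simp add: cov_deriv_form_def)
qed

lemma hesse_einstein: "hesse_einstein M A D g"
  using hessian koszul2_eq by (auto simp: hesse_einstein_def)

end

theorem corollary4p7:
  fixes M :: "'m topology"
    and A :: "('m, 'n::finite) chart set"
    and D nabla :: "('m, 'n) chart \<Rightarrow> 'n local_conn"
    and g :: "('m, 'n) chart \<Rightarrow> 'n local_metric"
    and f :: "'m \<Rightarrow> real"
    and lam :: real
  assumes "compact_space M"
    and "gradient_hesse_soliton M A D g nabla f lam"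
    and "\<forall>c\<in>A. \<forall>x\<in>chart_image c. \<forall>i j.
           koszul2 (D c) (g c) x i j = koszul2 (dual_conn nabla D c) (g c) x i j"
  shows "hesse_einstein M A D g"
proof -
  interpret equal_koszul_soliton M A D nabla g f lam by unfold_locales (fact assms)+
  show ?thesis by (rule hesse_einstein)
qed

end
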